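(* Let $n\ge 2$. The maps $\Gamma$ from the set of triangulations of $C(n+2,3)$ to the set of persistent graphs on vertex set $[n]$, and $\Xi$ from the set of persistent graphs on $[n]$ to the set of triangulations of $C(n+2,3)$, are well defined and mutually inverse bijections.
   Context: The cyclic polytope $C(n+2,3)$ is the convex hull of $n+2$ points on the moment curve $t\mapsto(t,t^2,t^3)$, with vertices labelled $0,\dots,n+1$ in increasing order of the parameter; simplices and faces are identified with their vertex sets. A triangulation is a set $T$ of 3-simplices (4-element vertex subsets) whose convex hulls cover the polytope and pairwise intersect in a common (possibly empty) face; $F_1(T)$ denotes the set of 2-element sets contained in some simplex of $T$. $\Gamma(T)=([n],F_1(T)\cap\binom{[n]}{2})$. A graph $G=([n],E)$ is persistent if (1) $\{i,i+1\}\in E$ for all $1\le i<n$; (2) (X-property) if $\{a,c\},\{b,d\}\in E$ for $a<b<c<d$ then $\{a,d\}\in E$; (3) (bar-property) for every edge $\{a,b\}\in E$ with $a<b-1$ there is $x$ with $a<x<b$ and $\{a,x\},\{x,b\}\in E$. $\hat G$ is the graph on $\{0,\dots,n+1\}$ with edge set $E$ together with all pairs containing $0$ or $n+1$. For $e=\{v,w\}\in E$ with $v<w$, $\ell_G(e)=\max\{i : i<v,\ \{i,w\}\in E(\hat G)\}$, $r_G(e)=\min\{i : w<i,\ \{i,v\}\in E(\hat G)\}$, $\xi_G(e)=\{\ell_G(e),v,w,r_G(e)\}$, and $\Xi(G)=\{\xi_G(e): e\in E\}$. *)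

theory Defs
  imports "HOL-Analysis.Analysis"
begin

definition moment :: "real \<Rightarrow> real \<times> real \<times> real" where
  "moment s = (s, s^2, s^3)"

text \<open>Vertex i of C(n+2,3), given the (strictly increasing) parameters t 0 < ... < t (n+1).\<close>
definition cpt :: "(nat \<Rightarrow> real) \<Rightarrow> nat \<Rightarrow> real \<times> real \<times> real" where
  "cpt t i = moment (t i)"

definition triangulation :: "nat \<Rightarrow> (nat \<Rightarrow> real) \<Rightarrow> nat set set \<Rightarrow> bool" where
  "triangulation n t T \<longleftrightarrow>
     (\<forall>S\<in>T. S \<subseteq> {0..n+1} \<and> card S = 4) \<and>
     (\<Union>S\<in>T. convex hull (cpt t ` S)) = convex hull (cpt t ` {0..n+1}) \<and>
     (\<forall>S1\<in>T. \<forall>S2\<in>T. convex hull (cpt t ` S1) \<inter> convex hull (cpt t ` S2)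
                         = convex hull (cpt t ` (S1 \<inter> S2)))"

definition F1 :: "nat set set \<Rightarrow> nat set set" where
  "F1 T = {e. card e = 2 \<and> (\<exists>S\<in>T. e \<subseteq> S)}"

definition Gamma :: "nat \<Rightarrow> nat set set \<Rightarrow> nat set set" where
  "Gamma n T = {e \<in> F1 T. e \<subseteq> {1..n}}"

text \<open>Graphs on [n] are represented by their edge sets (2-element subsets of {1..n}).\<close>
definition persistent :: "nat \<Rightarrow> nat set set \<Rightarrow> bool" where
  "persistent n E \<longleftrightarrow>
     (\<forall>e\<in>E. card e = 2 \<and> e \<subseteq> {1..n}) \<and>
     (\<forall>i. 1 \<le> i \<and> i < n \<longrightarrow> {i, i+1} \<in> E) \<and>
     (\<forall>a b c d. a < b \<and> b < c \<and> c < d \<and> {a,c} \<in> E \<and> {b,d} \<in> E \<longrightarrow> {a,d} \<in> E) \<and>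
     (\<forall>a b. {a,b} \<in> E \<and> a < b - 1 \<longrightarrow> (\<exists>x. a < x \<and> x < b \<and> {a,x} \<in> E \<and> {x,b} \<in> E))"

definition hatE :: "nat \<Rightarrow> nat set set \<Rightarrow> nat set set" where
  "hatE n E = E \<union> {{i,j} | i j. i \<noteq> j \<and> i \<le> n+1 \<and> j \<le> n+1 \<and> (i = 0 \<or> i = n+1)}"

definition lG :: "nat \<Rightarrow> nat set set \<Rightarrow> nat \<Rightarrow> nat \<Rightarrow> nat" where
  "lG n E v w = Max {i. i < v \<and> {i, w} \<in> hatE n E}"

definition rG :: "nat \<Rightarrow> nat set set \<Rightarrow> nat \<Rightarrow> nat \<Rightarrow> nat" where
  "rG n E v w = Min {i. w < i \<and> {i, v} \<in> hatE n E}"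

definition xiG :: "nat \<Rightarrow> nat set set \<Rightarrow> nat set \<Rightarrow> nat set" where
  "xiG n E e = (let v = Min e; w = Max e in {lG n E v w, v, w, rG n E v w})"

definition Xi :: "nat \<Rightarrow> nat set set \<Rightarrow> nat set set" where
  "Xi n E = xiG n E ` E"

end

theory Submission
  imports Defs
begin

text \<open>Let \<open>N = n + 1\<close>. An affine dependency between points of the moment curve has at least four sign
  changes, since otherwise a cubic with its roots at the sign changes would pair positively with it. So
  two simplices meet in a common face iff no triangle \<open>a < c < e\<close> of one and edge \<open>b < d\<close> of the other
  alternate, \<open>a < b < c < d < e\<close> (a circuit).

  For a persistent graph, the absence of circuits among the \<open>\<xi>\<close>-simplices follows from the X- and the
  bar-property. That they cover the polytope is seen by climbing along the third coordinate: every
  point lies above a facet \<open>{0, i, i + 1}\<close>, and every facet of a \<open>\<xi>\<close>-simplex that does not lie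
  on the upper boundary is a lower facet of some \<open>\<xi>\<close>-simplex.

  For a triangulation, the conditions on the graph come from looking at which simplices contain the
  midpoint of a potential edge, or points close to it. The absence of circuits gives
  \<open>T \<subseteq> \<Xi>(\<Gamma>(T))\<close>, and both sides are triangulations, so they agree.\<close>

section \<open>Persistent graphs\<close>

text \<open>The adjacency of \<open>hatE\<close>, oriented from the smaller to the larger vertex,
  with \<open>N\<close> for \<open>n + 1\<close>. Coning with \<open>0\<close> and \<open>N\<close>
  preserves the path, X- and bar-property, so cone edges rarely need separate treatment.\<close>

locale hat_graph =
  fixes N :: nat and H :: "nat \<Rightarrow> nat \<Rightarrow> bool"
  assumes H_dom: "H i j \<Longrightarrow> i < j \<and> j \<le> N"
    and H_0: "0 < j \<Longrightarrow> j \<le> N \<Longrightarrow> H 0 j"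
    and H_N: "j < N \<Longrightarrow> H j N"
    and H_path: "i < N \<Longrightarrow> H i (Suc i)"
    and H_X: "a < b \<Longrightarrow> b < c \<Longrightarrow> c < d \<Longrightarrow> H a c \<Longrightarrow> H b d \<Longrightarrow> H a d"
    and H_bar: "H a b \<Longrightarrow> Suc a < b \<Longrightarrow> \<exists>x. H a x \<and> H x b"
begin

text \<open>The simplex \<open>xiG\<close> of the edge \<open>{v, w}\<close>: maximality of
  \<open>l\<close> and minimality of \<open>r\<close> are stated as gaps among the neighbours. The
  bounds on \<open>v\<close> and \<open>w\<close> exclude cone edges.\<close>

definition quad :: "nat \<Rightarrow> nat \<Rightarrow> nat \<Rightarrow> nat \<Rightarrow> bool" where
  "quad l v w r \<longleftrightarrow> 0 < v \<and> w < N \<and> H v w \<and>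
     H l w \<and> l < v \<and> (\<forall>i. l < i \<and> i < v \<longrightarrow> \<not> H i w) \<and>
     H v r \<and> w < r \<and> (\<forall>i. w < i \<and> i < r \<longrightarrow> \<not> H v i)"

text \<open>Descend from \<open>w\<close> along neighbours of \<open>l\<close>: the bar-property
  splits the edge from \<open>l\<close> to \<open>x\<close> at some \<open>y\<close>. If
  \<open>y < v\<close>, the X-property against \<open>H v w\<close> (or \<open>x = w\<close> itself)
  yields \<open>H y w\<close>, contradicting the gap. So the descent stays above \<open>v\<close>
  until it hits \<open>v\<close>.\<close>

lemma left_triangle:
  assumes "H v w" "H l w" "l < v" and gap: "\<forall>i. l < i \<and> i < v \<longrightarrow> \<not> H i w"
  shows "H l v"
proof -
  have "H l v" if "H l x" "v \<le> x" "x \<le> w" for x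
    using that
  proof (induction x rule: less_induct)
    case (less x)
    show ?case
    proof (cases "x = v")
      case False
      then obtain y where y: "H l y" "H y x" using H_bar[of l x] less.prems assms by force
      have "l < y" "y < x" using y H_dom by blast+
      have "\<not> y < v"
      proof
        assume "y < v"
        then have "H y w" using H_X[of y v x w] y less.prems assms False by (cases "x = w") auto
        then show False using gap \<open>l < y\<close> \<open>y < v\<close> by blast
      qed
      then show ?thesis using less.IH[of y] y less.prems \<open>y < x\<close> by auto
    qed (use less in auto)
  qed
  moreover have "v < w" using assms H_dom by blast
  ultimately show ?thesis using assms by auto
qed

text \<open>Mirror image of \<open>left_triangle\<close>, climbing from \<open>v\<close> to
  \<open>w\<close> along neighbours of \<open>r\<close>.\<close>

lemma right_triangle:
  assumes "H v w" "H v r" "w < r" and gap: "\<forall>i. w < i \<and> i < r \<longrightarrow> \<not> H v i"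
  shows "H w r"
proof -
  have "H w r" if "H x r" "v \<le> x" "x \<le> w" for x
    using that
  proof (induction "w - x" arbitrary: x rule: less_induct)
    case less
    show ?case
    proof (cases "x = w")
      case False
      then obtain y where y: "H x y" "H y r" using H_bar[of x r] less.prems assms by force
      have "x < y" "y < r" using y H_dom by blast+
      have "\<not> w < y"
      proof
        assume "w < y"
        then have "H v y" using H_X[of v x w y] y less.prems assms False by (cases "x = v") auto
        then show False using gap \<open>y < r\<close> \<open>w < y\<close> by blast
      qed
      then show ?thesis using less.hyps[of y] y less.prems \<open>x < y\<close> by auto
    qed (use less in auto)
  qed
  moreover have "v < w" using assms H_dom by blast
  ultimately show ?thesis using assms by auto
qed

lemma quad_edges:
  assumes "quad l v w r"
  shows "l < v" "v < w" "w < r" "r \<le> N" "H l v" "H l w" "H l r" "H v w" "H v r" "H w r"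
proof -
  show "l < v" "v < w" "w < r" "r \<le> N" "H l w" "H v w" "H v r" using assms H_dom unfolding quad_def by auto
  then show "H l r" using H_X[of l v w r] by auto
  show "H l v" using left_triangle[of v w l] assms unfolding quad_def by blast
  show "H w r" using right_triangle[of v w r] assms unfolding quad_def by blast
qed

lemma quad_edge:
  assumes "quad l v w r" "x \<in> {l,v,w,r}" "y \<in> {l,v,w,r}" "x < y"
  shows "H x y"
  using quad_edges[OF assms(1)] assms(2-4) by auto

text \<open>The bar-property splits a straddling edge at some \<open>x\<close>. If \<open>x\<close>
  is below \<open>v\<close> or above \<open>w\<close>, one part is a shorter straddling edge. If
  \<open>x\<close> is \<open>v\<close> or \<open>w\<close>, one part contradicts a gap; strictly
  between them, the X-property against \<open>H v w\<close> yields \<open>H b w\<close>, again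
  contradicting a gap.\<close>

lemma quad_no_straddle:
  assumes q: "quad l v w r" and "H b d" "l < b" "b < v" "w < d" "d < r"
  shows False
  using assms(2-)
proof (induction "d - b" arbitrary: b d rule: less_induct)
  case less
  note e = quad_edges[OF q]
  have g1: "\<not> H i w" if "l < i" "i < v" for i using q that unfolding quad_def by blast
  have g2: "\<not> H v i" if "w < i" "i < r" for i using q that unfolding quad_def by blast
  obtain x where x: "H b x" "H x d" using H_bar[of b d] less.prems e by force
  then have bx: "b < x" "x < d" using H_dom by blast+
  consider "x < v" | "x = v" | "v < x" "x < w" | "x = w" | "w < x" by linarith
  then show False
  proof cases
    case 1
    moreover have "d - x < d - b" using bx by linarith
    ultimately show ?thesis using less.hyps[of d x] x bx less.prems by linarith
  next
    case 2 then show ?thesis using g2 x less.prems by auto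
  next
    case 3
    then have "H b w" using H_X[of b v x w] x e less.prems by auto
    then show ?thesis using g1 less.prems by auto
  next
    case 4 then show ?thesis using g1 x less.prems by auto
  next
    case 5
    moreover have "x - b < d - b" using bx by linarith
    ultimately show ?thesis using less.hyps[of x b] x bx less.prems by linarith
  qed
qed

text \<open>The middle vertex \<open>c\<close> is \<open>v\<close> or \<open>w\<close>. If
  \<open>c = v\<close>, then \<open>a = l\<close> and \<open>b\<close> lies in the left gap:
  \<open>d < w\<close> yields \<open>H b w\<close> by the X-property, \<open>d = w\<close> is that
  edge itself, and \<open>d > w\<close> makes a straddling edge. The case \<open>c = w\<close> is
  symmetric.\<close>

lemma quad_no_circuit:
  assumes q: "quad l v w r" and "{a,c,e} \<subseteq> {l,v,w,r}" "H b d" "a < b" "b < c" "c < d" "d < e"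
  shows False
proof -
  note e = quad_edges[OF q]
  have g1: "\<not> H i w" if "l < i" "i < v" for i using q that unfolding quad_def by blast
  have g2: "\<not> H v i" if "w < i" "i < r" for i using q that unfolding quad_def by blast
  have X1: "d < w \<Longrightarrow> c = v \<Longrightarrow> H b w" using H_X[of b v d w] assms e by auto
  have X2: "v < b \<Longrightarrow> c = w \<Longrightarrow> H v d" using H_X[of v b w d] assms e by auto
  have a: "l \<le> a" "e \<le> r" using assms(2) e by auto
  have "c = v \<or> c = w" using assms(2,4-) e by auto
  then show False
  proof
    assume c: "c = v"
    then have "a = l" using assms(2,4-) e by auto
    then show False using X1 c g1[of b] assms quad_no_straddle[OF q, of b d] a
      by (cases d w rule: linorder_cases) auto
  next
    assume c: "c = w"
    then have "e = r" using assms(2,4-) e by auto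
    then show False using X2 c g2[of d] assms quad_no_straddle[OF q, of b d] a
      by (cases b v rule: linorder_cases) auto
  qed
qed

text \<open>The triangles of the graph that no edge pierces; the climb passes from one of these to
  the next.\<close>

definition face :: "nat \<Rightarrow> nat \<Rightarrow> nat \<Rightarrow> bool" where
  "face a b c \<longleftrightarrow> H a b \<and> H b c \<and> H a c \<and>
     (\<forall>x y. a < x \<and> x < b \<and> b < y \<and> y < c \<longrightarrow> \<not> H x y)"

lemma quad_face:
  assumes "quad l v w r" "{a,b,c} \<subseteq> {l,v,w,r}" "a < b" "b < c"
  shows "face a b c"
proof -
  have "H a b" "H b c" "H a c" using quad_edge[OF assms(1)] assms(2-) by auto
  then show ?thesis unfolding face_def using quad_no_circuit[OF assms(1,2)] by blast
qed

text \<open>By the signs in \<open>four_point_dependency\<close>, the lower facets of a simplex are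
  those omitting its largest or its second smallest vertex; these are the two alternatives. The
  excluded triples \<open>{a, a + 1, N}\<close> are the facets of the upper boundary.\<close>

lemma face_is_lower_facet:
  assumes f: "face a b c" and nb: "\<not> (b = Suc a \<and> c = N)"
  shows "(\<exists>d. quad a b c d) \<or> (\<exists>v. quad a v b c)"
proof (cases "c < N \<and> (\<forall>i. a < i \<and> i < b \<longrightarrow> \<not> H i c)")
  case True
  define d where "d = (LEAST d. c < d \<and> H b d)"
  have ab: "a < b" "b < c" using f H_dom unfolding face_def by blast+
  have ex: "c < N \<and> H b N" using H_N True ab by auto
  have "c < d \<and> H b d" unfolding d_def by (rule LeastI[where k=N]) (use ex in auto)
  moreover have "\<forall>i. c < i \<and> i < d \<longrightarrow> \<not> H b i" unfolding d_def using not_less_Least by blast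
  ultimately have "quad a b c d" using f ab True unfolding quad_def face_def by auto
  then show ?thesis by blast
next
  case False
  have ab: "a < b" "b < c" "c \<le> N" using f H_dom unfolding face_def by blast+
  have "\<exists>i. a < i \<and> i < b \<and> H i c"
  proof (cases "c = N")
    case True
    \<comment> \<open>For \<open>c = N\<close> the cone edge from \<open>Suc a\<close> is a witness:
      \<open>nb\<close> places \<open>Suc a\<close> strictly below \<open>b\<close>.\<close>
    then show ?thesis using H_N[of "Suc a"] ab nb by (intro exI[of _ "Suc a"]) auto
  qed (use False ab in auto)
  then obtain i0 where i0: "a < i0 \<and> i0 < b \<and> H i0 c" by blast
  define P where "P i \<longleftrightarrow> a < i \<and> i < b \<and> H i c" for i
  \<comment> \<open>Taking \<open>i\<close> as close to \<open>b\<close> as possible creates the gap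
    that \<open>left_triangle\<close> needs to give \<open>H i b\<close>.\<close>
  define i where "i = (GREATEST i. P i)"
  have bd: "\<And>y. P y \<Longrightarrow> y \<le> b" unfolding P_def by auto
  have i: "P i" unfolding i_def by (rule GreatestI_nat[where k=i0 and b=b]) (use i0 bd in \<open>auto simp: P_def\<close>)
  have imax: "y \<le> i" if "P y" for y unfolding i_def by (rule Greatest_le_nat[where b=b]) (use that bd in auto)
  have Hib: "H i b"
  proof (rule left_triangle)
    show "\<forall>j. i < j \<and> j < b \<longrightarrow> \<not> H j c"
      using i imax unfolding P_def by (meson less_trans not_le)
  qed (use i f in \<open>auto simp: P_def face_def\<close>)
  \<comment> \<open>The smallest choice of \<open>v\<close> makes \<open>a\<close> the left vertex
    for the edge \<open>{v, b}\<close>; that \<open>c\<close> is its right vertex follows since no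
    edge pierces the face.\<close>
  define v where "v = (LEAST v. a < v \<and> H v b)"
  have v: "a < v \<and> H v b" unfolding v_def by (rule LeastI[where k=i]) (use Hib i in \<open>auto simp: P_def\<close>)
  have vi: "v \<le> i" unfolding v_def by (rule Least_le) (use Hib i in \<open>auto simp: P_def\<close>)
  have vmin: "\<forall>j. a < j \<and> j < v \<longrightarrow> \<not> H j b" unfolding v_def using not_less_Least by blast
  have vc: "H v c"
    using vi i v H_X[of v i b c] ab by (cases "v = i") (auto simp: P_def)
  have "quad a v b c" unfolding quad_def using f v vmin vc ab vi i by (auto simp: face_def P_def)
  then show ?thesis by blast
qed

end

section \<open>Weights on the moment curve\<close>

definition mom :: "nat \<Rightarrow> (nat \<Rightarrow> real) \<Rightarrow> (nat \<Rightarrow> real) \<Rightarrow> nat \<Rightarrow> real" where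
  "mom N t u k = (\<Sum>i\<le>N. u i * t i ^ k)"

lemma mom_add: "mom N t (\<lambda>i. u i + s * v i) k = mom N t u k + s * mom N t v k"
  by (simp add: mom_def algebra_simps sum.distrib sum_distrib_left)

lemma mom_diff: "mom N t (\<lambda>i. u i - v i) k = mom N t u k - mom N t v k"
  by (simp add: mom_def algebra_simps sum_subtractf)

lemma mom_minus: "mom N t (\<lambda>i. - u i) k = - mom N t u k"
  by (simp add: mom_def sum_negf)

lemma mom_supp:
  assumes "S \<subseteq> {..N}" "\<And>i. i \<notin> S \<Longrightarrow> u i = 0"
  shows "mom N t u k = (\<Sum>i\<in>S. u i * t i ^ k)"
  unfolding mom_def by (rule sum.mono_neutral_right) (use assms in auto)

text \<open>Total functions vanishing off \<open>S\<close>, so that weights on different simplices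
  can be subtracted. The mass is left free; it is the zeroth moment.\<close>

definition weights :: "nat set \<Rightarrow> (nat \<Rightarrow> real) \<Rightarrow> bool" where
  "weights S u \<longleftrightarrow> (\<forall>i. 0 \<le> u i) \<and> (\<forall>i. i \<notin> S \<longrightarrow> u i = 0)"

lemma weightsD: "weights S u \<Longrightarrow> 0 \<le> u i" "weights S u \<Longrightarrow> 0 < u i \<Longrightarrow> i \<in> S"
  unfolding weights_def by force+

lemma weights_mono: "weights S u \<Longrightarrow> S \<subseteq> S' \<Longrightarrow> weights S' u"
  unfolding weights_def by auto

lemma sum_cpt: "(\<Sum>i\<in>A. u i *\<^sub>R cpt t i) = (\<Sum>i\<in>A. u i * t i, \<Sum>i\<in>A. u i * t i ^ 2, \<Sum>i\<in>A. u i * t i ^ 3)"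
  by (simp add: prod_eq_iff fst_sum snd_sum cpt_def moment_def)

lemma hull_cpt_iff:
  assumes "S \<subseteq> {..N}"
  shows "x \<in> convex hull (cpt t ` S) \<longleftrightarrow>
    (\<exists>u. weights S u \<and> mom N t u 0 = 1 \<and> x = (mom N t u 1, mom N t u 2, mom N t u 3))"
proof -
  have sub: "cpt t ` S \<subseteq> {x. \<exists>u. weights S u \<and> mom N t u 0 = 1 \<and> x = (mom N t u 1, mom N t u 2, mom N t u 3)}" (is "_ \<subseteq> ?C")
  proof
    fix x assume "x \<in> cpt t ` S"
    then obtain i where i: "i \<in> S" "x = cpt t i" by blast
    define u where "u j = (if j = i then 1 else 0 :: real)" for j
    have "mom N t u k = t i ^ k" for k
      using mom_supp[of "{i}" N u t k] i assms by (auto simp: u_def)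
    then have "weights S u \<and> mom N t u 0 = 1 \<and> x = (mom N t u 1, mom N t u 2, mom N t u 3)"
      using i by (auto simp: weights_def u_def cpt_def moment_def)
    then show "x \<in> ?C" by blast
  qed
  have "convex ?C"
    unfolding convex_def
  proof (intro ballI allI impI)
    fix x y and a b :: real
    assume "x \<in> ?C" "y \<in> ?C" and ab: "0 \<le> a" "0 \<le> b" "a + b = 1"
    then obtain u v where
      u: "weights S u" "mom N t u 0 = 1" "x = (mom N t u 1, mom N t u 2, mom N t u 3)" and
      v: "weights S v" "mom N t v 0 = 1" "y = (mom N t v 1, mom N t v 2, mom N t v 3)" by blast
    have m: "mom N t (\<lambda>i. a * u i + b * v i) k = a * mom N t u k + b * mom N t v k" for k
      by (simp add: mom_def algebra_simps sum.distrib sum_distrib_left)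
    have "weights S (\<lambda>i. a * u i + b * v i)" using u v ab by (auto simp: weights_def)
    then show "a *\<^sub>R x + b *\<^sub>R y \<in> ?C"
      using u v ab m by (intro CollectI exI[of _ "\<lambda>i. a * u i + b * v i"]) simp
  qed
  then have "convex hull (cpt t ` S) \<subseteq> ?C" using sub by (simp add: hull_minimal)
  moreover have "x \<in> convex hull (cpt t ` S)"
    if u: "weights S u" "mom N t u 0 = 1" "x = (mom N t u 1, mom N t u 2, mom N t u 3)" for u
  proof -
  have m: "mom N t u k = (\<Sum>i\<in>S. u i * t i ^ k)" for k
    by (rule mom_supp) (use u assms in \<open>auto simp: weights_def\<close>)
  have "x = (\<Sum>i\<in>S. u i *\<^sub>R cpt t i)" using u m by (simp add: sum_cpt)
  moreover have "\<dots> \<in> convex hull (cpt t ` S)"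
  proof (rule convex_sum)
    show "finite S" using assms finite_subset by blast
    show "sum u S = 1" using m[of 0] u by simp
  qed (use u in \<open>auto simp: weights_def intro: hull_inc\<close>)
  ultimately show ?thesis by simp
  qed
  ultimately show ?thesis by blast
qed

section \<open>Affine dependencies between points of the moment curve\<close>

locale curve =
  fixes N :: nat and t :: "nat \<Rightarrow> real"
  assumes t_mono: "strict_mono_on {..N} t"
begin

abbreviation "mm \<equiv> mom N t"

lemma t_less: "i < j \<Longrightarrow> j \<le> N \<Longrightarrow> t i < t j"
  using t_mono by (simp add: strict_mono_on_def)

lemma t_le: "i \<le> j \<Longrightarrow> j \<le> N \<Longrightarrow> t i \<le> t j"
  using t_less[of i j] by (cases "i = j") auto

lemma mom_cubic:
  "(\<Sum>i\<le>N. u i * ((t i - p) * (t i - q) * (t i - r))) =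
    mm u 3 - (p + q + r) * mm u 2 + (p * q + p * r + q * r) * mm u 1 - p * q * r * mm u 0"
  unfolding mom_def sum_distrib_left sum_subtractf[symmetric] sum.distrib[symmetric]
  by (rule sum.cong) (auto simp: algebra_simps power2_eq_square power3_eq_cube)

lemma mom_quadratic:
  "(\<Sum>i\<le>N. u i * ((t i - p) * (t i - q))) = mm u 2 - (p + q) * mm u 1 + p * q * mm u 0"
  unfolding mom_def sum_distrib_left sum_subtractf[symmetric] sum.distrib[symmetric]
  by (rule sum.cong) (auto simp: algebra_simps power2_eq_square)

lemma mom_linear: "(\<Sum>i\<le>N. u i * (t i - p)) = mm u 1 - p * mm u 0"
  unfolding mom_def sum_distrib_left sum_subtractf[symmetric] sum.distrib[symmetric]
  by (rule sum.cong) (auto simp: algebra_simps)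

lemma no_dep:
  fixes f q :: "nat \<Rightarrow> real"
  assumes "\<And>i. i \<le> N \<Longrightarrow> 0 \<le> f i * q i" "a \<le> N" "0 < f a * q a" "(\<Sum>i\<le>N. f i * q i) = 0"
  shows False
  using sum_pos2[of "{..N}" a "\<lambda>i. f i * q i"] assms by auto

definition alternates :: "(nat \<Rightarrow> real) \<Rightarrow> nat \<Rightarrow> nat \<Rightarrow> nat \<Rightarrow> nat \<Rightarrow> nat \<Rightarrow> bool" where
  "alternates f a b c d e \<longleftrightarrow> a < b \<and> b < c \<and> c < d \<and> d < e \<and> e \<le> N \<and>
     0 < f a \<and> f b < 0 \<and> 0 < f c \<and> f d < 0 \<and> 0 < f e"

lemma first_index:
  fixes P :: "nat \<Rightarrow> bool"
  assumes "\<exists>i>a. i \<le> N \<and> P i"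
  obtains b where "a < b" "b \<le> N" "P b" "\<And>i. a < i \<Longrightarrow> i < b \<Longrightarrow> \<not> P i"
proof -
  define b where "b = (LEAST i. a < i \<and> i \<le> N \<and> P i)"
  have "a < b \<and> b \<le> N \<and> P b" unfolding b_def by (rule LeastI_ex) (use assms in blast)
  moreover have "\<not> P i" if "a < i" "i < b" for i
    using not_less_Least[of i "\<lambda>i. a < i \<and> i \<le> N \<and> P i"] that calculation unfolding b_def[symmetric] by auto
  ultimately show ?thesis using that by blast
qed

text \<open>If \<open>f\<close> had at most three sign changes, a cubic with its roots at the sign changes would
  make every term of the vanishing sum \<open>\<Sum>i. f i * q (t i)\<close> nonnegative.\<close>

lemma alternates_if_first_pos:
  assumes dep: "\<And>k. k \<le> 3 \<Longrightarrow> mm f k = 0"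
    and a: "a \<le> N" "0 < f a" and first: "\<And>i. i < a \<Longrightarrow> f i = 0"
  shows "\<exists>b c d e. alternates f a b c d e"
proof -
  have m: "mm f 0 = 0" "mm f 1 = 0" "mm f 2 = 0" "mm f 3 = 0" using dep by auto
  have "\<exists>i>a. i \<le> N \<and> f i < 0"
  proof (rule ccontr)
    assume no: "\<not> ?thesis"
    have "0 \<le> f i" if "i \<le> N" for i
      using no first[of i] a that by (cases i a rule: linorder_cases) force+
    then show False
      using no_dep[of f "\<lambda>_. 1" a] a m(1) by (simp add: mom_def)
  qed
  then obtain b where b: "a < b" "b \<le> N" "f b < 0" "\<And>i. a < i \<Longrightarrow> i < b \<Longrightarrow> \<not> f i < 0"
    using first_index[of a "\<lambda>i. f i < 0"] by blast
  have s1: "0 \<le> f i" if "i < b" for i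
    using b(4)[of i] first[of i] a that by (cases i a rule: linorder_cases) auto
  have "\<exists>i>b. i \<le> N \<and> f i > 0"
  proof (rule ccontr)
    assume no: "\<not> ?thesis"
    show False
    proof (rule no_dep[of "f" "\<lambda>i. - (t i - t b)" a])
      fix i assume "i \<le> N"
      consider "i < b" | "i = b" | "b < i" by linarith
      then show "0 \<le> f i * - (t i - t b)"
      proof cases
        case 1 then show ?thesis using s1 t_less[of i b] b by (intro mult_nonneg_nonneg) auto
      next
        case 3 then have "f i \<le> 0" "t b < t i" using no \<open>i \<le> N\<close> t_less by force+
          then show ?thesis by (intro mult_nonpos_nonpos) auto
      qed auto
    next
      show "(\<Sum>i\<le>N. f i * - (t i - t b)) = 0"
        unfolding mult_minus_right sum_negf using mom_linear[of f "t b"] m by simp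
      show "0 < f a * - (t a - t b)" using a b t_less[of a b] by simp
    qed (use a in auto)
  qed
  then obtain c where c: "b < c" "c \<le> N" "f c > 0" "\<And>i. b < i \<Longrightarrow> i < c \<Longrightarrow> \<not> f i > 0"
    using first_index[of b "\<lambda>i. f i > 0"] by blast
  have s2: "f i \<le> 0" if "b \<le> i" "i < c" for i using c(4)[of i] b that by (cases "i = b") auto
  have "\<exists>i>c. i \<le> N \<and> f i < 0"
  proof (rule ccontr)
    assume no: "\<not> ?thesis"
    show False
    proof (rule no_dep[of "f" "\<lambda>i. (t i - t b) * (t i - t c)" a])
      fix i assume "i \<le> N"
      consider "i < b" | "b \<le> i" "i < c" | "c \<le> i" by linarith
      then show "0 \<le> f i * ((t i - t b) * (t i - t c))"
      proof cases
        case 1 then show ?thesis using s1 t_less[of i b] t_less[of i c] b c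
          by (intro mult_nonneg_nonneg mult_nonpos_nonpos) auto
      next
        case 2 then show ?thesis using s2 t_le[of b i] t_less[of i c] b c \<open>i \<le> N\<close>
          by (intro mult_nonpos_nonpos mult_nonneg_nonpos) auto
      next
        case 3 then have "f i \<ge> 0" using no c \<open>i \<le> N\<close> by (cases "i = c") force+
        then show ?thesis using 3 t_le[of b i] t_le[of c i] b c \<open>i \<le> N\<close> by (intro mult_nonneg_nonneg) auto
      qed
    next
      show "(\<Sum>i\<le>N. f i * ((t i - t b) * (t i - t c))) = 0"
        using mom_quadratic[of f "t b" "t c"] m by simp
      show "0 < f a * ((t a - t b) * (t a - t c))"
        using a b c t_less[of a b] t_less[of a c] by (intro mult_pos_pos mult_neg_neg) auto
    qed (use a in auto)
  qed
  then obtain d where d: "c < d" "d \<le> N" "f d < 0" "\<And>i. c < i \<Longrightarrow> i < d \<Longrightarrow> \<not> f i < 0"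
    using first_index[of c "\<lambda>i. f i < 0"] by blast
  have s3: "f i \<ge> 0" if "c \<le> i" "i < d" for i using d(4)[of i] c that by (cases "i = c") auto
  have "\<exists>i>d. i \<le> N \<and> f i > 0"
  proof (rule ccontr)
    assume no: "\<not> ?thesis"
    show False
    proof (rule no_dep[of "f" "\<lambda>i. - ((t i - t b) * (t i - t c) * (t i - t d))" a])
      fix i assume "i \<le> N"
      consider "i < b" | "b \<le> i" "i < c" | "c \<le> i" "i < d" | "d \<le> i" by linarith
      then have "f i * ((t i - t b) * (t i - t c) * (t i - t d)) \<le> 0"
      proof cases
        case 1 then show ?thesis using s1 t_less[of i b] t_less[of i c] t_less[of i d] b c d
          by (intro mult_nonneg_nonpos[OF _ mult_nonneg_nonpos] mult_nonpos_nonpos) auto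
      next
        case 2 then show ?thesis using s2 t_le[of b i] t_less[of i c] t_less[of i d] b c d \<open>i \<le> N\<close>
          by (intro mult_nonpos_nonneg[OF _ mult_nonpos_nonpos] mult_nonneg_nonpos) auto
      next
        case 3 then show ?thesis using s3 t_le[of b i] t_le[of c i] t_less[of i d] b c d \<open>i \<le> N\<close>
          by (intro mult_nonneg_nonpos[OF _ mult_nonneg_nonpos] mult_nonneg_nonneg) auto
      next
        case 4 then have "f i \<le> 0" using no d \<open>i \<le> N\<close> by (cases "i = d") force+
        then show ?thesis using 4 t_le[of b i] t_le[of c i] t_le[of d i] b c d \<open>i \<le> N\<close>
          by (intro mult_nonpos_nonneg mult_nonneg_nonneg) auto
      qed
      then show "0 \<le> f i * - ((t i - t b) * (t i - t c) * (t i - t d))" by simp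
    next
      show "(\<Sum>i\<le>N. f i * - ((t i - t b) * (t i - t c) * (t i - t d))) = 0"
        unfolding mult_minus_right sum_negf using mom_cubic[of f "t b" "t c" "t d"] m by simp
      have "(t a - t b) * (t a - t c) * (t a - t d) < 0"
        using a b c d t_less[of a b] t_less[of a c] t_less[of a d] by (intro mult_pos_neg mult_neg_neg) auto
      then show "0 < f a * - ((t a - t b) * (t a - t c) * (t a - t d))"
        using a by (simp add: mult_pos_neg)
    qed (use a in auto)
  qed
  then obtain e where e: "d < e" "e \<le> N" "f e > 0" by blast
  have "alternates f a b c d e"
    unfolding alternates_def using a b(1,3) c(1,3) d(1,3) e by simp
  then show ?thesis by blast
qed

lemma dependency_alternates:
  assumes dep: "\<And>k. k \<le> 3 \<Longrightarrow> mm f k = 0" and "j \<le> N" "f j \<noteq> 0"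
  shows "\<exists>a b c d e. alternates f a b c d e \<or> alternates (\<lambda>i. - f i) a b c d e"
proof -
  define a where "a = (LEAST i. f i \<noteq> 0)"
  have a: "f a \<noteq> 0" unfolding a_def by (rule LeastI) (rule assms(3))
  have "a \<le> j" unfolding a_def by (rule Least_le) (rule assms(3))
  have first: "f i = 0" if "i < a" for i using that not_less_Least unfolding a_def by blast
  show ?thesis
  proof (cases "0 < f a")
    case True
    then have "\<exists>b c d e. alternates f a b c d e"
      using dep first \<open>a \<le> j\<close> assms(2) by (intro alternates_if_first_pos) auto
    then show ?thesis by blast
  next
    case False
    then have "\<exists>b c d e. alternates (\<lambda>i. - f i) a b c d e"
      using dep first \<open>a \<le> j\<close> assms(2) a by (intro alternates_if_first_pos) (auto simp: mom_minus)
    then show ?thesis by blast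
  qed
qed

text \<open>If \<open>u - v\<close> is not zero it is an affine dependency and alternates at five
  indices. Where it is positive \<open>u\<close> is positive, so the index is in \<open>Z\<close>;
  where it is negative the index is in \<open>S\<close>.\<close>

lemma weights_eq_or_circuit:
  assumes u: "weights Z u" and v: "weights S v" and m: "\<And>k. k \<le> 3 \<Longrightarrow> mm u k = mm v k"
    and "Z \<subseteq> {..N}" "S \<subseteq> {..N}"
  obtains "u = v"
  | a b c d e where "a < b" "b < c" "c < d" "d < e" "e \<le> N" "{a,c,e} \<subseteq> Z" "{b,d} \<subseteq> S" "v a < u a" "v c < u c" "v e < u e" "u b < v b" "u d < v d"
  | a b c d e where "a < b" "b < c" "c < d" "d < e" "e \<le> N" "{a,c,e} \<subseteq> S" "{b,d} \<subseteq> Z" "u a < v a" "u c < v c" "u e < v e" "v b < u b" "v d < u d"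
proof (cases "u = v")
  case False
  define f where "f i = u i - v i" for i
  obtain j where j: "u j \<noteq> v j" using False by auto
  then have "j \<in> Z \<union> S" using u v unfolding weights_def by (metis UnI1 UnI2)
  then have "j \<le> N" using assms by auto
  moreover have "mm f k = 0" if "k \<le> 3" for k using m that unfolding f_def by (simp add: mom_diff)
  moreover have "f j \<noteq> 0" using j by (simp add: f_def)
  ultimately obtain a b c d e where
    alt: "alternates f a b c d e \<or> alternates (\<lambda>i. - f i) a b c d e"
    using dependency_alternates[of f j] by metis
  have p: "i \<in> Z" if "v i < u i" for i using that weightsD[OF u, of i] weightsD[OF v, of i] by auto
  have n: "i \<in> S" if "u i < v i" for i using that weightsD[OF u, of i] weightsD[OF v, of i] by auto
  show ?thesis
    using alt
  proof
    assume "alternates f a b c d e"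
    then show ?thesis using p n by (intro that(2)[of a b c d e]) (auto simp: alternates_def f_def)
  next
    assume "alternates (\<lambda>i. - f i) a b c d e"
    then show ?thesis using p n by (intro that(3)[of a b c d e]) (auto simp: alternates_def f_def)
  qed
qed (use that in blast)

text \<open>A circuit would place five indices in \<open>S\<close>: at most four points of the curve
  are affinely independent.\<close>

lemma weights_unique:
  assumes "weights S u" "weights S v" "\<And>k. k \<le> 3 \<Longrightarrow> mm u k = mm v k" "S \<subseteq> {..N}" "card S \<le> 4"
  shows "u = v"
proof -
  have no: "False" if "a < b" "b < c" "c < d" "d < e" "{a,c,e} \<subseteq> S" "{b,d} \<subseteq> S" for a b c d e :: nat
  proof -
    have "card {a,b,c,d,e} \<le> card S" by (rule card_mono) (use that assms finite_subset in auto)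
    then show False using that assms by simp
  qed
  show ?thesis
  proof (rule weights_eq_or_circuit[OF assms(1,2,3,4,4)])
    fix a b c d e
    assume "a < b" "b < c" "c < d" "d < e" "{a,c,e} \<subseteq> S" "{b,d} \<subseteq> S"
    then show "u = v" using no[of a b c d e] by simp
  next
    fix a b c d e
    assume "a < b" "b < c" "c < d" "d < e" "{a,c,e} \<subseteq> S" "{b,d} \<subseteq> S"
    then show "u = v" using no[of a b c d e] by simp
  qed
qed

text \<open>Up to scaling, \<open>g\<close> is the divided difference operator on the four nodes.\<close>

lemma four_point_dependency:
  assumes "a < b" "b < c" "c < d" "d \<le> N"
  obtains g where "g a < 0" "0 < g b" "g c < 0" "0 < g d" "\<And>i. i \<notin> {a,b,c,d} \<Longrightarrow> g i = 0"
    "mm g 0 = 0" "mm g 1 = 0" "mm g 2 = 0" "mm g 3 = 1"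
proof -
  define A B C D where "A = t a" and "B = t b" and "C = t c" and "D = t d"
  have lt: "A < B" "B < C" "C < D" "A < C" "A < D" "B < D" using assms t_less unfolding A_def B_def C_def D_def by auto
  \<comment> \<open>The Vandermonde product. It is the common denominator of the divided difference
    coefficients, each the reciprocal of the product of the differences of one node with the other
    three.\<close>
  define V where "V = (D - C) * (D - B) * (D - A) * (C - B) * (C - A) * (B - A)"
  have V: "V > 0" using lt unfolding V_def by simp
  define g where "g i = (if i = a then - ((D - C) * (D - B) * (C - B)) / V else
     if i = b then (D - C) * (D - A) * (C - A) / V else
     if i = c then - ((D - B) * (D - A) * (B - A)) / V else
     if i = d then (C - B) * (C - A) * (B - A) / V else 0)" for i
  have ne: "a \<noteq> b" "a \<noteq> c" "a \<noteq> d" "b \<noteq> c" "b \<noteq> d" "c \<noteq> d" using assms by auto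
  have m: "mm g k = (- ((D - C) * (D - B) * (C - B)) * A ^ k + (D - C) * (D - A) * (C - A) * B ^ k
     - ((D - B) * (D - A) * (B - A)) * C ^ k + (C - B) * (C - A) * (B - A) * D ^ k) / V" for k
  proof -
    have "mm g k = (\<Sum>i\<in>{a,b,c,d}. g i * t i ^ k)"
      by (rule mom_supp) (use assms in \<open>auto simp: g_def\<close>)
    also have "\<dots> = g a * A ^ k + g b * B ^ k + g c * C ^ k + g d * D ^ k"
      using ne by (simp add: A_def B_def C_def D_def)
    also have "\<dots> = (- ((D - C) * (D - B) * (C - B)) * A ^ k + (D - C) * (D - A) * (C - A) * B ^ k
     - ((D - B) * (D - A) * (B - A)) * C ^ k + (C - B) * (C - A) * (B - A) * D ^ k) / V"
      using ne unfolding g_def by (simp add: add_divide_distrib diff_divide_distrib)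
    finally show ?thesis .
  qed
  have "- ((D - C) * (D - B) * (C - B)) * A ^ 3 + (D - C) * (D - A) * (C - A) * B ^ 3
     - ((D - B) * (D - A) * (B - A)) * C ^ 3 + (C - B) * (C - A) * (B - A) * D ^ 3 = V"
    unfolding V_def by algebra
  then have "mm g 3 = 1" using V unfolding m by simp
  moreover have "mm g 0 = 0" "mm g 1 = 0" "mm g 2 = 0" 
    unfolding m by (simp_all add: algebra_simps power2_eq_square)
  moreover have "g a < 0" "0 < g b" "g c < 0" "0 < g d"
    using ne lt V unfolding g_def by (auto intro!: divide_neg_pos divide_pos_pos)
  moreover have "g i = 0" if "i \<notin> {a,b,c,d}" for i using that by (auto simp: g_def)
  ultimately show ?thesis using that by blast
qed

text \<open>The difference of two four-point dependencies loses its third moment. At the shared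
  nodes their signs are opposite, so subtracting cancels nothing and the signs alternate.\<close>

lemma five_point_dependency:
  assumes "a < b" "b < c" "c < d" "d < e" "e \<le> N"
  obtains h where "0 < h a" "h b < 0" "0 < h c" "h d < 0" "0 < h e"
    "\<And>i. i \<notin> {a,b,c,d,e} \<Longrightarrow> h i = 0" "\<And>k. k \<le> 3 \<Longrightarrow> mm h k = 0"
proof -
  obtain g where g: "g a < 0" "0 < g b" "g c < 0" "0 < g d" "\<And>i. i \<notin> {a,b,c,d} \<Longrightarrow> g i = 0"
    "mm g 0 = 0" "mm g 1 = 0" "mm g 2 = 0" "mm g 3 = 1"
    using four_point_dependency[of a b c d] assms by auto
  obtain g' where g': "g' b < 0" "0 < g' c" "g' d < 0" "0 < g' e" "\<And>i. i \<notin> {b,c,d,e} \<Longrightarrow> g' i = 0"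
    "mm g' 0 = 0" "mm g' 1 = 0" "mm g' 2 = 0" "mm g' 3 = 1"
    using four_point_dependency[of b c d e] assms by auto
  have z: "g e = 0" "g' a = 0" using g(5)[of e] g'(5)[of a] assms by auto
  show ?thesis
  proof (rule that[of "\<lambda>i. g' i - g i"])
    show "mm (\<lambda>i. g' i - g i) k = 0" if "k \<le> 3" for k
    proof -
      have "k = 0 \<or> k = 1 \<or> k = 2 \<or> k = 3" using that by linarith
      then show ?thesis using g g' unfolding mom_diff by auto
    qed
  qed (use g g' z in auto)
qed

end

section \<open>The climb through the simplices of a persistent graph\<close>

lemma all_le_3: "(\<forall>k\<le>3. P k) \<longleftrightarrow> P 0 \<and> P 1 \<and> P 2 \<and> P (3::nat)"
proof -
  have "k = 0 \<or> k = 1 \<or> k = 2 \<or> k = 3" if "k \<le> 3" for k :: nat using that by linarith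
  then show ?thesis by auto
qed

lemma all_le_2: "(\<forall>k\<le>2. P k) \<longleftrightarrow> P 0 \<and> P 1 \<and> P (2::nat)"
proof -
  have "k = 0 \<or> k = 1 \<or> k = 2" if "k \<le> 2" for k :: nat using that by linarith
  then show ?thesis by auto
qed

section \<open>Common faces of simplices, and the single steps of the climb\<close>

context curve
begin

definition pt :: "(nat \<Rightarrow> real) \<Rightarrow> real \<times> real \<times> real" where
  "pt u = (mm u 1, mm u 2, mm u 3)"

lemma hull_iff:
  assumes "S \<subseteq> {..N}"
  shows "x \<in> convex hull (cpt t ` S) \<longleftrightarrow> (\<exists>u. weights S u \<and> mm u 0 = 1 \<and> x = pt u)"
  unfolding pt_def by (rule hull_cpt_iff[OF assms])

lemma pt_eqD: "pt u = pt v \<Longrightarrow> mm u 0 = mm v 0 \<Longrightarrow> k \<le> 3 \<Longrightarrow> mm u k = mm v k"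
  using all_le_3[of "\<lambda>k. mm u k = mm v k"] unfolding pt_def by simp

lemma pt_eqI: "(\<And>k. k \<le> 3 \<Longrightarrow> mm u k = mm v k) \<Longrightarrow> pt u = pt v"
  unfolding pt_def by simp

text \<open>A common point has weights on both sets with the same moments. Without circuits these
  weights coincide, so they are supported on the intersection.\<close>

lemma hull_Int_no_circuit:
  assumes S: "S1 \<subseteq> {..N}" "S2 \<subseteq> {..N}"
    and c12: "\<And>a b c d e. a < b \<Longrightarrow> b < c \<Longrightarrow> c < d \<Longrightarrow> d < e \<Longrightarrow> {a,c,e} \<subseteq> S1 \<Longrightarrow> {b,d} \<subseteq> S2 \<Longrightarrow> False"
    and c21: "\<And>a b c d e. a < b \<Longrightarrow> b < c \<Longrightarrow> c < d \<Longrightarrow> d < e \<Longrightarrow> {a,c,e} \<subseteq> S2 \<Longrightarrow> {b,d} \<subseteq> S1 \<Longrightarrow> False"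
  shows "convex hull (cpt t ` S1) \<inter> convex hull (cpt t ` S2) = convex hull (cpt t ` (S1 \<inter> S2))"
proof
  show "convex hull (cpt t ` (S1 \<inter> S2)) \<subseteq> convex hull (cpt t ` S1) \<inter> convex hull (cpt t ` S2)"
    by (intro Int_greatest hull_mono image_mono) auto
next
  show "convex hull (cpt t ` S1) \<inter> convex hull (cpt t ` S2) \<subseteq> convex hull (cpt t ` (S1 \<inter> S2))"
  proof
    fix x assume "x \<in> convex hull (cpt t ` S1) \<inter> convex hull (cpt t ` S2)"
    then obtain u v where u: "weights S1 u" "mm u 0 = 1" "x = pt u"
      and v: "weights S2 v" "mm v 0 = 1" "x = pt v"
      using hull_iff[OF S(1)] hull_iff[OF S(2)] by auto
    have "mm u k = mm v k" if "k \<le> 3" for k using pt_eqD[of u v k] u v that by simp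
    then have "u = v"
    proof (rule weights_eq_or_circuit[OF u(1) v(1) _ S])
      fix a b c d e
      assume "a < b" "b < c" "c < d" "d < e" "{a,c,e} \<subseteq> S1" "{b,d} \<subseteq> S2"
      then show "u = v" using c12[of a b c d e] by simp
    next
      fix a b c d e
      assume "a < b" "b < c" "c < d" "d < e" "{a,c,e} \<subseteq> S2" "{b,d} \<subseteq> S1"
      then show "u = v" using c21[of a b c d e] by simp
    qed
    then have "weights (S1 \<inter> S2) u" using u v unfolding weights_def by auto
    then show "x \<in> convex hull (cpt t ` (S1 \<inter> S2))"
      using u hull_iff[of "S1 \<inter> S2"] S by blast
  qed
qed

text \<open>The positive and negative parts of a five-point dependency represent one common point.
  Its weights on the intersection would equal both by \<open>weights_unique\<close>, but only the
  first part charges \<open>a\<close>.\<close>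

lemma no_circuit_if_hull_Int:
  assumes S: "S1 \<subseteq> {..N}" "S2 \<subseteq> {..N}" "card S1 \<le> 4" "card S2 \<le> 4"
    and int: "convex hull (cpt t ` S1) \<inter> convex hull (cpt t ` S2) \<subseteq> convex hull (cpt t ` (S1 \<inter> S2))"
    and lt: "a < b" "b < c" "c < d" "d < e" and sub: "{a,c,e} \<subseteq> S1" "{b,d} \<subseteq> S2"
  shows False
proof -
  have "e \<le> N" using S sub by auto
  then obtain h where h: "0 < h a" "h b < 0" "0 < h c" "h d < 0" "0 < h e"
    "\<And>i. i \<notin> {a,b,c,d,e} \<Longrightarrow> h i = 0" "\<And>k. k \<le> 3 \<Longrightarrow> mm h k = 0"
    using five_point_dependency[OF lt] by blast
  \<comment> \<open>The mass of the positive part and, as \<open>mm h 0 = 0\<close>, also of the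
    negative part; dividing by it normalises both.\<close>
  define s where "s = h a + h c + h e"
  have s: "s > 0" using h unfolding s_def by simp
  define u where "u i = max (h i) 0 / s" for i
  define v where "v i = max (- h i) 0 / s" for i
  have wu: "weights {a,c,e} u"
    unfolding weights_def
  proof (intro conjI allI impI)
    fix i assume "i \<notin> {a,c,e}"
    then have "h i \<le> 0" using h(2,4) h(6)[of i] by (cases "i = b \<or> i = d") auto
    then show "u i = 0" unfolding u_def by simp
  qed (use s in \<open>auto simp: u_def\<close>)
  have wv: "weights {b,d} v"
    unfolding weights_def
  proof (intro conjI allI impI)
    fix i assume "i \<notin> {b,d}"
    then have "h i \<ge> 0" using h(1,3,5) h(6)[of i] by (cases "i = a \<or> i = c \<or> i = e") auto
    then show "v i = 0" unfolding v_def by simp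
  qed (use s in \<open>auto simp: v_def\<close>)
  have "mm u 0 = (\<Sum>i\<in>{a,c,e}. u i * t i ^ 0)"
    by (rule mom_supp) (use sub S wu in \<open>auto simp: weights_def\<close>)
  then have "mm u 0 = 1" using lt h s by (simp add: u_def s_def add_divide_distrib[symmetric])
  have h': "u = (\<lambda>i. v i + (1 / s) * h i)"
    using s by (auto simp: u_def v_def max_def field_simps)
  have eq: "mm u k = mm v k" if "k \<le> 3" for k
    using mom_add[of N t v "1/s" h k] h(7)[OF that] unfolding h'[symmetric] by simp
  have "pt u \<in> convex hull (cpt t ` S1)"
    using hull_iff[OF S(1)] weights_mono[OF wu sub(1)] \<open>mm u 0 = 1\<close> by blast
  moreover have "pt u \<in> convex hull (cpt t ` S2)"
    using hull_iff[OF S(2)] weights_mono[OF wv sub(2)] \<open>mm u 0 = 1\<close> eq[of 0] pt_eqI[OF eq] by auto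
  ultimately have "pt u \<in> convex hull (cpt t ` (S1 \<inter> S2))" using int by blast
  then obtain w where w: "weights (S1 \<inter> S2) w" "mm w 0 = 1" "pt u = pt w"
    using hull_iff[of "S1 \<inter> S2"] S by blast
  have eqw: "mm u k = mm w k" if "k \<le> 3" for k using pt_eqD[of u w] w \<open>mm u 0 = 1\<close> that by simp
  have "u = w"
    by (rule weights_unique[OF weights_mono[OF wu sub(1)] weights_mono[OF w(1)] eqw S(1,3)]) auto
  moreover have "v = w"
    by (rule weights_unique[OF weights_mono[OF wv sub(2)] weights_mono[OF w(1)] _ S(2,4)]) (use eq eqw in auto)
  moreover have "v a = 0" using wv lt unfolding weights_def by auto
  moreover have "u a > 0" using h s unfolding u_def by simp
  ultimately show False by simp
qed

text \<open>Each step pushes the weights of the two extreme points \<open>b < d\<close> down onto \<open>0\<close> and \<open>b + 1\<close>.\<close>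

lemma above_lower_facet:
  assumes "weights ({0} \<union> {b..d}) u" "0 < b" "b \<le> d" "d \<le> N" "2 \<le> N"
  shows "\<exists>i v. 0 < i \<and> i < N \<and> weights {0,i,Suc i} v \<and> (\<forall>k\<le>2. mm v k = mm u k) \<and> mm v 3 \<le> mm u 3"
  using assms
proof (induction "d - b" arbitrary: b d u rule: less_induct)
  case less
  show ?case
  proof (cases "d \<le> Suc b")
    case True
    \<comment> \<open>For \<open>b = N\<close> there is no vertex \<open>Suc b\<close>, and the last
      facet \<open>{0, N - 1, N}\<close> is used; \<open>2 \<le> N\<close> keeps its middle vertex
      positive.\<close>
    define i where "i = (if b < N then b else N - 1)"
    have "{0} \<union> {b..d} \<subseteq> {0,i,Suc i}" using True less.prems unfolding i_def by auto
    then have "weights {0,i,Suc i} u" using less.prems(1) weights_mono by blast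
    moreover have "0 < i" "i < N" using less.prems unfolding i_def by auto
    ultimately show ?thesis by blast
  next
    case False
    then obtain g where g: "g 0 < 0" "0 < g b" "g (Suc b) < 0" "0 < g d"
      "\<And>i. i \<notin> {0,b,Suc b,d} \<Longrightarrow> g i = 0"
      "mm g 0 = 0" "mm g 1 = 0" "mm g 2 = 0" "mm g 3 = 1"
      using four_point_dependency[of 0 b "Suc b" d] less.prems by auto
    \<comment> \<open>The largest multiple of \<open>g\<close> that can be subtracted while the
      weights at \<open>b\<close> and \<open>d\<close> stay nonnegative. One of them vanishes, so
      the interval loses an end, and the third moment drops by \<open>s\<close>.\<close>
    define s where "s = min (u b / g b) (u d / g d)"
    define v where "v i = u i + (- s) * g i" for i
    have u0: "u i \<ge> 0" for i using less.prems(1) weightsD by blast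
    have s0: "s \<ge> 0" unfolding s_def using u0 g by simp
    have sb: "s * g b \<le> u b" "s * g d \<le> u d"
      using g unfolding s_def by (simp_all add: min_def field_simps)
    have v0: "v i \<ge> 0" for i
    proof -
      consider "i = b" | "i = d" | "g i \<le> 0" using g(1,3) g(5)[of i] by fastforce
      then show ?thesis
      proof cases
        case 3
        then have "s * g i \<le> 0" using s0 by (simp add: mult_nonneg_nonpos)
        then show ?thesis using u0[of i] unfolding v_def by simp
      qed (use sb in \<open>auto simp: v_def\<close>)
    qed
    have vz: "v i = 0" if "i \<notin> {0} \<union> {b..d}" for i
      using that g(5)[of i] less.prems(1) False unfolding v_def weights_def by auto
    have m: "\<forall>k\<le>2. mm v k = mm u k" "mm v 3 \<le> mm u 3"
      unfolding v_def mom_add all_le_2 using g s0 by auto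
    have "s = u b / g b \<or> s = u d / g d" unfolding s_def by (simp add: min_def)
    then have "v b = 0 \<or> v d = 0" using g unfolding v_def by auto
    then obtain b' d' where bd: "0 < b'" "b' \<le> d'" "d' \<le> N" "d' - b' < d - b" "weights ({0} \<union> {b'..d'}) v"
    proof
      assume "v b = 0"
      then have "v i = 0" if "i \<notin> {0} \<union> {Suc b..d}" for i using vz[of i] that \<open>v b = 0\<close> by (cases "i = b") force+
      then have "weights ({0} \<union> {Suc b..d}) v" using v0 unfolding weights_def by blast
      then show ?thesis using False less.prems(2-4) by (intro that[of "Suc b" d]) auto
    next
      assume "v d = 0"
      then have "v i = 0" if "i \<notin> {0} \<union> {b..d - 1}" for i using vz[of i] that \<open>v d = 0\<close> by (cases "i = d") force+
      then have "weights ({0} \<union> {b..d - 1}) v" using v0 unfolding weights_def by blast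
      then show ?thesis using False less.prems(2-4) by (intro that[of b "d - 1"]) auto
    qed
    obtain i w where "0 < i" "i < N" "weights {0,i,Suc i} w" "\<forall>k\<le>2. mm w k = mm v k" "mm w 3 \<le> mm v 3"
      using less.hyps[OF bd(4,5,1,2,3) less.prems(5)] by blast
    then show ?thesis using m by (intro exI[of _ i] exI[of _ w]) simp
  qed
qed

text \<open>The monic cubic \<open>q\<close> vanishes on the facet and is nonpositive at every
  vertex. As the lower moments agree, pairing both weights with \<open>q\<close> compares exactly
  the third moments.\<close>

lemma below_upper_facet:
  assumes "weights {..N} u" "weights {i,Suc i,N} v" "Suc i \<le> N" "\<forall>k\<le>2. mm v k = mm u k"
  shows "mm u 3 \<le> mm v 3"
proof -
  define q where "q j = (t j - t i) * (t j - t (Suc i)) * (t j - t N)" for j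
  have "(\<Sum>j\<le>N. v j * q j) = 0"
  proof (rule sum.neutral, intro ballI)
    fix j
    show "v j * q j = 0" using assms(2) unfolding weights_def q_def by (cases "j \<in> {i,Suc i,N}") auto
  qed
  moreover have "(\<Sum>j\<le>N. u j * q j) \<le> 0"
  proof (rule sum_nonpos)
    fix j assume "j \<in> {..N}"
    then have j: "t j \<le> t N" using t_le by auto
    have "(t j - t i) * (t j - t (Suc i)) \<ge> 0"
    proof (cases "j \<le> i")
      case True
      then show ?thesis using t_le[of j i] t_le[of j "Suc i"] assms(3) by (intro mult_nonpos_nonpos) auto
    next
      case False
      then show ?thesis using t_le[of i j] t_le[of "Suc i" j] \<open>j \<in> {..N}\<close> by (intro mult_nonneg_nonneg) auto
    qed
    then have "q j \<le> 0" unfolding q_def using j by (simp add: mult_nonneg_nonpos)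
    then show "u j * q j \<le> 0" using weightsD(1)[OF assms(1), of j] by (simp add: mult_nonneg_nonpos)
  qed
  moreover have "mm v 0 = mm u 0" "mm v 1 = mm u 1" "mm v 2 = mm u 2" using assms(4) by auto
  ultimately show ?thesis unfolding q_def mom_cubic by simp
qed

text \<open>Adding multiples of the four-point dependency moves the point straight up and drains the
  weights at \<open>a\<close> and \<open>c\<close>. Either height \<open>z\<close> is reached inside
  the simplex, or the path leaves through the upper facet opposite \<open>a\<close> or
  \<open>c\<close>.\<close>

lemma climb_through_simplex:
  assumes "a < b" "b < c" "c < d" "d \<le> N" and u: "weights {a,b,c,d} u" "mm u 3 \<le> z"
  obtains v where "weights {a,b,c,d} v" "\<forall>k\<le>2. mm v k = mm u k" "mm v 3 = z"
  | v where "weights {b,c,d} v \<or> weights {a,b,d} v" "\<forall>k\<le>2. mm v k = mm u k" "mm v 3 < z"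
proof -
  obtain g where g: "g a < 0" "0 < g b" "g c < 0" "0 < g d" "\<And>i. i \<notin> {a,b,c,d} \<Longrightarrow> g i = 0"
    "mm g 0 = 0" "mm g 1 = 0" "mm g 2 = 0" "mm g 3 = 1"
    using four_point_dependency[of a b c d] assms by auto
  \<comment> \<open>The height gained until the first of the weights at \<open>a\<close> and
    \<open>c\<close> vanishes.\<close>
  define s0 where "s0 = min (u a / - g a) (u c / - g c)"
  have u0: "u i \<ge> 0" for i using u(1) weightsD by blast
  have s0: "s0 \<ge> 0" unfolding s0_def using u0 g by (simp add: divide_nonneg_neg)
  have w: "weights {a,b,c,d} (\<lambda>i. u i + s * g i)" if "0 \<le> s" "s \<le> s0" for s
    unfolding weights_def
  proof (intro conjI allI impI)
    fix i
    have a: "0 \<le> u i + s * g i" if "g i < 0" "s \<le> u i / - g i"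
      using that by (simp add: field_simps)
    have "0 \<le> u i + s * g i" if "g i \<ge> 0" using that u0[of i] \<open>0 \<le> s\<close> by simp
    then show "0 \<le> u i + s * g i"
      using a \<open>s \<le> s0\<close> g(2,4) g(5)[of i] unfolding s0_def by (cases "i = a \<or> i = c") force+
    show "u i + s * g i = 0" if "i \<notin> {a,b,c,d}" using that g(5) u(1) unfolding weights_def by auto
  qed
  have m: "\<forall>k\<le>2. mm (\<lambda>i. u i + s * g i) k = mm u k" "mm (\<lambda>i. u i + s * g i) 3 = mm u 3 + s" for s
    unfolding mom_add all_le_2 using g by auto
  show ?thesis
  proof (cases "z - mm u 3 \<le> s0")
    case True
    then show ?thesis
      using that(1)[of "\<lambda>i. u i + (z - mm u 3) * g i"] w[of "z - mm u 3"] m[of "z - mm u 3"] u(2) by auto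
  next
    case False
    have "s0 = u a / - g a \<or> s0 = u c / - g c" unfolding s0_def by (simp add: min_def)
    then have "u a + s0 * g a = 0 \<or> u c + s0 * g c = 0" using g by (auto simp: field_simps)
    then have "weights {b,c,d} (\<lambda>i. u i + s0 * g i) \<or> weights {a,b,d} (\<lambda>i. u i + s0 * g i)"
      using w[of s0] s0 unfolding weights_def by auto
    then show ?thesis using that(2)[of "\<lambda>i. u i + s0 * g i"] m[of s0] False by auto
  qed
qed

end

section \<open>Covering the polytope by the simplices of a persistent graph\<close>

locale hat_curve = hat_graph N H + curve N t
  for N :: nat and H :: "nat \<Rightarrow> nat \<Rightarrow> bool" and t :: "nat \<Rightarrow> real"
begin

text \<open>Each step replaces a facet below the given point by a higher one. Regardless of the geometry,
  its minimum goes up, or its maximum goes up, or its middle element goes down, in this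
  lexicographic order; so the climb ends.\<close>

lemma climb:
  assumes u: "weights {..N} u"
    and "face a b c" "\<not> (b = Suc a \<and> c = N)" "weights {a,b,c} v" "\<forall>k\<le>2. mm v k = mm u k" "mm v 3 \<le> mm u 3"
  shows "\<exists>l v' w r \<alpha>. quad l v' w r \<and> weights {l,v',w,r} \<alpha> \<and> (\<forall>k\<le>3. mm \<alpha> k = mm u k)"
  using assms(2-)
proof (induction "(a,b,c)" arbitrary: a b c v
    rule: wf_induct_rule[OF wf_measures[of "[\<lambda>(a,b,c). N - a, \<lambda>(a,b,c). N - c, \<lambda>(a,b,c). b]"]])
  case 1
  have ab: "a < b" "b < c" "c \<le> N" using 1(2) H_dom unfolding face_def by blast+
  have next_face: ?case
    if "face a' b' c'" "weights {a',b',c'} v'" "\<forall>k\<le>2. mm v' k = mm v k" "mm v' 3 < mm u 3"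
      and "((a',b',c'),(a,b,c)) \<in> measures [\<lambda>(a,b,c). N - a, \<lambda>(a,b,c). N - c, \<lambda>(a,b,c). b]"
    for a' b' c' v'
  proof -
    \<comment> \<open>A facet of the upper boundary cannot have a point strictly below the target,
      so the climb can continue from the new face.\<close>
    have "\<not> (b' = Suc a' \<and> c' = N)"
      using below_upper_facet[of u a' v'] u that 1(5) H_dom[of a' b'] unfolding face_def by auto
    then show ?thesis using 1(1)[of a' b' c' v'] that 1(5) by auto
  qed
  consider d where "quad a b c d" | x where "quad a x b c" using face_is_lower_facet[OF 1(2,3)] by blast
  then show ?case
  proof cases
    case q: 1
    note e = quad_edges[OF q]
    have w: "weights {a,b,c,d} v" using 1(4) by (rule weights_mono) auto
    show ?thesis
    proof (rule climb_through_simplex[OF e(1-4) w 1(6)])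
      fix v' assume "weights {a,b,c,d} v'" "\<forall>k\<le>2. mm v' k = mm v k" "mm v' 3 = mm u 3"
      then show ?thesis using q 1(5) unfolding all_le_3 all_le_2 by metis
    next
      fix v' assume v': "weights {b,c,d} v' \<or> weights {a,b,d} v'" "\<forall>k\<le>2. mm v' k = mm v k" "mm v' 3 < mm u 3"
      have "face b c d" "face a b d" using quad_face[OF q] e by auto
      moreover have "N - b < N - a" "N - d < N - c" using e by auto
      ultimately show ?thesis using next_face[of b c d v'] next_face[of a b d v'] v' e by auto
    qed
  next
    case q: 2
    note e = quad_edges[OF q]
    have w: "weights {a,x,b,c} v" using 1(4) by (rule weights_mono) auto
    show ?thesis
    proof (rule climb_through_simplex[OF e(1-4) w 1(6)])
      fix v' assume "weights {a,x,b,c} v'" "\<forall>k\<le>2. mm v' k = mm v k" "mm v' 3 = mm u 3"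
      then show ?thesis using q 1(5) unfolding all_le_3 all_le_2 by metis
    next
      fix v' assume v': "weights {x,b,c} v' \<or> weights {a,x,c} v'" "\<forall>k\<le>2. mm v' k = mm v k" "mm v' 3 < mm u 3"
      have "face x b c" "face a x c" using quad_face[OF q] e by auto
      moreover have "N - x < N - a" using e by auto
      ultimately show ?thesis using next_face[of x b c v'] next_face[of a x c v'] v' e by auto
    qed
  qed
qed

lemma quads_cover:
  assumes u: "weights {..N} u" and N: "3 \<le> N"
  shows "\<exists>l v' w r \<alpha>. quad l v' w r \<and> weights {l,v',w,r} \<alpha> \<and> (\<forall>k\<le>3. mm \<alpha> k = mm u k)"
proof -
  have "{..N} = {0} \<union> {1..N}" by auto
  then obtain i v where i: "0 < i" "i < N" "weights {0,i,Suc i} v" "\<forall>k\<le>2. mm v k = mm u k" "mm v 3 \<le> mm u 3"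
    using above_lower_facet[of 1 N u] assms by auto
  \<comment> \<open>No vertex lies strictly between \<open>i\<close> and \<open>Suc i\<close>, so
    nothing pierces this triangle. By \<open>3 \<le> N\<close> it is not the upper facet
    \<open>{0, 1, N}\<close>, so the climb can start here.\<close>
  have "face 0 i (Suc i)" using i H_0 H_path unfolding face_def by auto
  then show ?thesis using climb[OF u _ _ i(3-5)] i N by auto
qed

end

section \<open>The two maps\<close>

definition hatH :: "nat \<Rightarrow> nat set set \<Rightarrow> nat \<Rightarrow> nat \<Rightarrow> bool" where
  "hatH n E i j \<longleftrightarrow> i < j \<and> {i, j} \<in> hatE n E"

lemma hatH_iff: "hatH n E i j \<longleftrightarrow> i < j \<and> ({i,j} \<in> E \<or> j \<le> n + 1 \<and> (i = 0 \<or> j = n + 1))"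
proof -
  let ?C = "{{x,y} | x y. x \<noteq> y \<and> x \<le> n + 1 \<and> y \<le> n + 1 \<and> (x = 0 \<or> x = n + 1)}"
  have "{i,j} \<in> ?C \<longleftrightarrow> j \<le> n + 1 \<and> (i = 0 \<or> j = n + 1)" if "i < j"
  proof
    assume "{i,j} \<in> ?C"
    then show "j \<le> n + 1 \<and> (i = 0 \<or> j = n + 1)" using that by (auto simp: doubleton_eq_iff)
  next
    assume j: "j \<le> n + 1 \<and> (i = 0 \<or> j = n + 1)"
    then consider "i = 0" | "j = n + 1" by blast
    then show "{i,j} \<in> ?C"
    proof cases
      case 1
      then show ?thesis using j that by (intro CollectI exI[of _ i] exI[of _ j]) auto
    next
      case 2
      then show ?thesis using j that by (intro CollectI exI[of _ j] exI[of _ i]) auto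
    qed
  qed
  then show ?thesis unfolding hatH_def hatE_def by blast
qed

lemma
  assumes "persistent n E"
  shows persistent_card2: "\<forall>e\<in>E. card e = 2 \<and> e \<subseteq> {1..n}"
    and persistent_path: "\<forall>i. 1 \<le> i \<and> i < n \<longrightarrow> {i, i + 1} \<in> E"
    and persistent_X: "\<forall>a b c d. a < b \<and> b < c \<and> c < d \<and> {a,c} \<in> E \<and> {b,d} \<in> E \<longrightarrow> {a,d} \<in> E"
    and persistent_bar: "\<forall>a b. {a,b} \<in> E \<and> a < b - 1 \<longrightarrow> (\<exists>x. a < x \<and> x < b \<and> {a,x} \<in> E \<and> {x,b} \<in> E)"
  using assms[unfolded persistent_def] by - (elim conjE, assumption)+

lemma persistent_edge:
  assumes "persistent n E" "{i,j} \<in> E"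
  shows "0 < i \<and> j \<le> n"
proof -
  have "{i,j} \<subseteq> {1..n}" using persistent_card2[OF assms(1)] assms(2) by blast
  then show ?thesis by auto
qed

text \<open>In the X-property, \<open>a = 0\<close> or \<open>d = n + 1\<close> makes the conclusion
  a cone edge; otherwise both given edges are in \<open>E\<close>. For the bar-property, a cone edge
  is split next to the end that is not its apex, into a path edge and another cone edge.\<close>

lemma hat_graph_hatH:
  assumes p: "persistent n E"
  shows "hat_graph (n + 1) (hatH n E)"
proof
  show "i < j \<and> j \<le> n + 1" if "hatH n E i j" for i j
    using that persistent_edge[OF p, of i j] by (auto simp: hatH_iff)
  show "hatH n E 0 j" if "0 < j" "j \<le> n + 1" for j using that by (simp add: hatH_iff)
  show "hatH n E j (n + 1)" if "j < n + 1" for j using that by (simp add: hatH_iff)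
  show path: "hatH n E i (Suc i)" if "i < n + 1" for i
    using persistent_path[OF p] that unfolding hatH_iff by (cases "i = 0 \<or> i = n") auto
  show "hatH n E a d" if "a < b" "b < c" "c < d" "hatH n E a c" "hatH n E b d" for a b c d
  proof (cases "a = 0 \<or> d = n + 1")
    case True
    then show ?thesis using that persistent_edge[OF p, of b d] by (auto simp: hatH_iff)
  next
    case False
    then have "{a,c} \<in> E" "{b,d} \<in> E" using that persistent_edge[OF p, of b d] by (auto simp: hatH_iff)
    then have "{a,d} \<in> E" using persistent_X[OF p] that by blast
    then show ?thesis using that by (simp add: hatH_iff)
  qed
  show "\<exists>x. hatH n E a x \<and> hatH n E x b" if ab: "hatH n E a b" "Suc a < b" for a b
  proof -
    have b: "b \<le> n + 1" using ab persistent_edge[OF p, of a b] by (auto simp: hatH_iff)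
    consider "a = 0" | "b = n + 1" | "{a,b} \<in> E" using ab by (auto simp: hatH_iff)
    then show ?thesis
    proof cases
      case 1
      then have "hatH n E a (b - 1)" "hatH n E (b - 1) b" using ab b path[of "b - 1"] by (auto simp: hatH_iff)
      then show ?thesis by blast
    next
      case 2
      then have "hatH n E a (Suc a)" "hatH n E (Suc a) b" using ab b path[of a] by (auto simp: hatH_iff)
      then show ?thesis by blast
    next
      case 3
      have "a < b - 1" using ab by simp
      then obtain x where "a < x" "x < b" "{a,x} \<in> E" "{x,b} \<in> E"
        using persistent_bar[OF p] 3 by blast
      then show ?thesis by (auto simp: hatH_iff)
    qed
  qed
qed

text \<open>The relation \<open>quad\<close> of the locale \<open>hat_graph\<close>, restated for edge sets that are not known to be
  persistent.\<close>

definition is_quad :: "nat \<Rightarrow> nat set set \<Rightarrow> nat \<Rightarrow> nat \<Rightarrow> nat \<Rightarrow> nat \<Rightarrow> bool" where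
  "is_quad n E l v w r \<longleftrightarrow> {v,w} \<in> E \<and> v < w \<and>
     hatH n E l w \<and> l < v \<and> (\<forall>i. l < i \<and> i < v \<longrightarrow> \<not> hatH n E i w) \<and>
     hatH n E v r \<and> w < r \<and> (\<forall>i. w < i \<and> i < r \<longrightarrow> \<not> hatH n E v i)"

lemma two_set:
  fixes e :: "nat set"
  assumes "card e = 2"
  obtains i j where "e = {i,j}" "i < j"
proof -
  obtain x y where xy: "e = {x,y}" "x \<noteq> y" using assms by (auto simp: card_2_iff)
  then show ?thesis using that[of x y] that[of y x] by (cases "x < y") auto
qed

lemma xiG_is_quad:
  assumes E: "\<forall>e\<in>E. card e = 2 \<and> e \<subseteq> {1..n}" and q: "is_quad n E l v w r"
  shows "xiG n E {v,w} = {l,v,w,r}"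
proof -
  have vw: "v < w" and l: "hatH n E l w" "l < v" and r: "hatH n E v r" "w < r"
    and gapl: "\<And>i. l < i \<Longrightarrow> i < v \<Longrightarrow> \<not> hatH n E i w" and gapr: "\<And>i. w < i \<Longrightarrow> i < r \<Longrightarrow> \<not> hatH n E v i"
    using q unfolding is_quad_def by auto
  have "{i. i < v \<and> {i,w} \<in> hatE n E} = {i. i < v \<and> hatH n E i w}"
    using vw unfolding hatH_def by auto
  then have "lG n E v w = Max {i. i < v \<and> hatH n E i w}" unfolding lG_def by simp
  also have "\<dots> = l"
  proof (rule Max_eqI)
    show "i \<le> l" if "i \<in> {i. i < v \<and> hatH n E i w}" for i
      using gapl[of i] that by (cases "l < i") auto
  qed (use l in auto)
  finally have lG: "lG n E v w = l" .
  have "{i,v} = {v,i}" for i by blast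
  then have "{i. w < i \<and> {i,v} \<in> hatE n E} = {i. w < i \<and> hatH n E v i}"
    using vw unfolding hatH_def by auto
  then have "rG n E v w = Min {i. w < i \<and> hatH n E v i}" unfolding rG_def by simp
  also have "\<dots> = r"
  proof (rule Min_eqI)
    have "i \<le> n + 1" if "hatH n E v i" for i
      using that bspec[OF E, of "{v,i}"] by (auto simp: hatH_iff)
    then have "{i. w < i \<and> hatH n E v i} \<subseteq> {..n + 1}" by auto
    then show "finite {i. w < i \<and> hatH n E v i}" by (rule finite_subset) simp
    show "r \<le> i" if "i \<in> {i. w < i \<and> hatH n E v i}" for i
      using gapr[of i] that by (cases "i < r") auto
  qed (use r in auto)
  finally have rG: "rG n E v w = r" .
  show ?thesis using vw lG rG unfolding xiG_def by (simp add: Let_def)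
qed

lemma is_quad_ex:
  assumes E: "\<forall>e\<in>E. card e = 2 \<and> e \<subseteq> {1..n}" and e: "e \<in> E"
  obtains l v w r where "e = {v,w}" "is_quad n E l v w r"
proof -
  obtain v w where vw: "e = {v,w}" "v < w" by (rule two_set[of e]) (use E e in auto)
  then have b: "0 < v" "w \<le> n" using E e by force+
  define P where "P i \<longleftrightarrow> i < v \<and> hatH n E i w" for i
  define l where "l = Greatest P"
  \<comment> \<open>The cone vertices \<open>0\<close> and \<open>n + 1\<close> are always
    candidates, so the extremal neighbours exist.\<close>
  have P0: "P 0" using vw b by (simp add: P_def hatH_iff)
  have l: "P l" unfolding l_def by (rule GreatestI_nat[of P 0 v]) (use P0 in \<open>auto simp: P_def\<close>)
  have lmax: "i \<le> l" if "P i" for i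
    unfolding l_def by (rule Greatest_le_nat[of P i v]) (use that in \<open>auto simp: P_def\<close>)
  define Q where "Q i \<longleftrightarrow> w < i \<and> hatH n E v i" for i
  define r where "r = Least Q"
  have "Q (n + 1)" using vw b by (simp add: Q_def hatH_iff)
  then have r: "Q r" unfolding r_def by (rule LeastI)
  have rmin: "\<not> Q i" if "i < r" for i using that not_less_Least unfolding r_def by blast
  have "is_quad n E l v w r"
    unfolding is_quad_def
    using vw e l r lmax rmin unfolding P_def Q_def by (auto simp flip: not_le)
  then show ?thesis using vw that by blast
qed

lemma Xi_I:
  assumes "\<forall>e\<in>E. card e = 2 \<and> e \<subseteq> {1..n}" and q: "is_quad n E l v w r"
  shows "{l,v,w,r} \<in> Xi n E"
proof -
  have "{v,w} \<in> E" using q unfolding is_quad_def by blast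
  then show ?thesis unfolding Xi_def xiG_is_quad[OF assms, symmetric] by (rule imageI)
qed

lemma Xi_eq:
  assumes E: "\<forall>e\<in>E. card e = 2 \<and> e \<subseteq> {1..n}"
  shows "S \<in> Xi n E \<longleftrightarrow> (\<exists>l v w r. is_quad n E l v w r \<and> S = {l,v,w,r})"
proof
  assume "S \<in> Xi n E"
  then obtain e where e: "e \<in> E" "S = xiG n E e" unfolding Xi_def by blast
  show "\<exists>l v w r. is_quad n E l v w r \<and> S = {l,v,w,r}"
    by (rule is_quad_ex[OF E e(1)]) (use e(2) xiG_is_quad[OF E] in auto)
next
  assume "\<exists>l v w r. is_quad n E l v w r \<and> S = {l,v,w,r}"
  then show "S \<in> Xi n E" using Xi_I[OF E] by (elim exE conjE) simp
qed

lemma is_quad_iff: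
  assumes p: "persistent n E"
  shows "is_quad n E l v w r \<longleftrightarrow> hat_graph.quad (n + 1) (hatH n E) l v w r"
  unfolding hat_graph.quad_def[OF hat_graph_hatH[OF p]] is_quad_def
  using persistent_edge[OF p, of v w] by (auto simp: hatH_iff[of n E v w])

text \<open>No edge is gained, since by \<open>quad_edge\<close> all six pairs in a simplex are
  edges of the hat graph; none is lost, since each edge lies in its own simplex.\<close>

lemma Gamma_Xi:
  assumes p: "persistent n E"
  shows "Gamma n (Xi n E) = E"
proof
  interpret hat_graph "n + 1" "hatH n E" by (rule hat_graph_hatH[OF p])
  have X: "S \<in> Xi n E \<longleftrightarrow> (\<exists>l v w r. quad l v w r \<and> S = {l,v,w,r})" for S
    using Xi_eq[OF persistent_card2[OF p], of S] is_quad_iff[OF p] by simp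
  show "Gamma n (Xi n E) \<subseteq> E"
  proof
    fix e assume "e \<in> Gamma n (Xi n E)"
    then obtain S where e: "card e = 2" "e \<subseteq> {1..n}" "S \<in> Xi n E" "e \<subseteq> S" unfolding Gamma_def F1_def by blast
    then obtain l v w r where q: "quad l v w r" "S = {l,v,w,r}" using X[of S] by blast
    obtain i j where ij: "e = {i,j}" "i < j" by (rule two_set[OF e(1)])
    then have "hatH n E i j" using quad_edge[OF q(1), of i j] e q(2) by auto
    then show "e \<in> E" using ij e by (auto simp: hatH_iff)
  qed
  show "E \<subseteq> Gamma n (Xi n E)"
  proof
    fix e assume e: "e \<in> E"
    obtain l v w r where q: "e = {v,w}" "is_quad n E l v w r" by (rule is_quad_ex[OF persistent_card2[OF p] e])
    have "{l,v,w,r} \<in> Xi n E" by (rule Xi_I[OF persistent_card2[OF p] q(2)])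
    then show "e \<in> Gamma n (Xi n E)"
      using q(1) bspec[OF persistent_card2[OF p] e] unfolding Gamma_def F1_def
      by (auto intro!: bexI[of _ "{l,v,w,r}"])
  qed
qed

lemma four_set:
  fixes S :: "nat set"
  assumes "card S = 4"
  obtains a b c d where "S = {a,b,c,d}" "a < b" "b < c" "c < d"
proof -
  have fin: "finite S" using assms by (metis card.infinite zero_neq_numeral)
  have "\<exists>a b c d. xs = [a,b,c,d]" if "length xs = 4" for xs :: "nat list"
    using that by (auto simp: length_Suc_conv numeral_eq_Suc)
  then obtain a b c d where l: "sorted_list_of_set S = [a,b,c,d]"
    using assms fin by fastforce
  have "S = set [a,b,c,d]" using l fin by (metis set_sorted_list_of_set)
  moreover have "sorted_wrt (<) [a,b,c,d]" using l by (metis strict_sorted_list_of_set)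
  ultimately show ?thesis using that[of a b c d] by simp
qed

section \<open>From persistent graphs to triangulations\<close>

context curve
begin

text \<open>All pairs in a simplex are edges of the hat graph, so \<open>quad_no_circuit\<close>
  rules out circuits between any two simplices, and these meet in common faces. The covering is
  \<open>quads_cover\<close>.\<close>

lemma triangulation_Xi:
  assumes p: "persistent n E" and N: "N = n + 1" "2 \<le> n"
  shows "triangulation n t (Xi n E)"
proof -
  interpret hat_curve N "hatH n E" t
    by (intro hat_curve.intro) (use hat_graph_hatH[OF p] N curve_axioms in auto)
  have X: "S \<in> Xi n E \<longleftrightarrow> (\<exists>l v w r. quad l v w r \<and> S = {l,v,w,r})" for S
    using Xi_eq[OF persistent_card2[OF p], of S] is_quad_iff[OF p] N by simp
  have S: "S \<subseteq> {..N} \<and> card S = 4" if S: "S \<in> Xi n E" for S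
  proof -
    obtain l v w r where q: "quad l v w r" "S = {l,v,w,r}" using X[of S] S by blast
    then show ?thesis using quad_edges(1-4)[OF q(1)] by auto
  qed
  have circ: False if S12: "S1 \<in> Xi n E" "S2 \<in> Xi n E" and "a < b" "b < c" "c < d" "d < e" "{a,c,e} \<subseteq> S1" "{b,d} \<subseteq> S2"
    for S1 S2 a b c d e
  proof -
    obtain l v w r where q: "quad l v w r" "S1 = {l,v,w,r}" using X[of S1] S12(1) by blast
    obtain l' v' w' r' where q': "quad l' v' w' r'" "S2 = {l',v',w',r'}" using X[of S2] S12(2) by blast
    have "hatH n E b d" using quad_edge[OF q'(1), of b d] that q'(2) by auto
    then show False using quad_no_circuit[OF q(1), of a c e b d] that q(2) by blast
  qed
  have "(\<Union>S\<in>Xi n E. convex hull (cpt t ` S)) = convex hull (cpt t ` {..N})"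
  proof
    show "(\<Union>S\<in>Xi n E. convex hull (cpt t ` S)) \<subseteq> convex hull (cpt t ` {..N})"
      using S by (intro UN_least hull_mono image_mono) blast
    show "convex hull (cpt t ` {..N}) \<subseteq> (\<Union>S\<in>Xi n E. convex hull (cpt t ` S))"
    proof
      fix x assume "x \<in> convex hull (cpt t ` {..N})"
      then obtain u where u: "weights {..N} u" "mm u 0 = 1" "x = pt u" using hull_iff[of "{..N}"] by blast
      then obtain l v w r \<alpha> where q: "quad l v w r" "weights {l,v,w,r} \<alpha>" "\<forall>k\<le>3. mm \<alpha> k = mm u k"
        using quads_cover[OF u(1)] N by auto
      have "{l,v,w,r} \<in> Xi n E" using q(1) by (intro iffD2[OF X] exI conjI) (assumption, rule refl)
      moreover have "mm \<alpha> 0 = 1" using q(3) u(2) by simp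
      moreover have "x = pt \<alpha>" using q(3) u(3) pt_eqI[of \<alpha> u] by simp
      ultimately have "x \<in> convex hull (cpt t ` {l,v,w,r})"
        using iffD2[OF hull_iff[of "{l,v,w,r}"]] S[of "{l,v,w,r}"] q(2) by blast
      then show "x \<in> (\<Union>S\<in>Xi n E. convex hull (cpt t ` S))" using \<open>{l,v,w,r} \<in> Xi n E\<close> by blast
    qed
  qed
  then show ?thesis
    unfolding triangulation_def atLeast0AtMost N(1)[symmetric]
  proof (intro conjI ballI)
    fix S1 S2 assume S12: "S1 \<in> Xi n E" "S2 \<in> Xi n E"
    show "convex hull (cpt t ` S1) \<inter> convex hull (cpt t ` S2) = convex hull (cpt t ` (S1 \<inter> S2))"
      using S[OF S12(1)] S[OF S12(2)]
      by (intro hull_Int_no_circuit circ[OF S12] circ[OF S12(2,1)]) auto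
  qed (use S in auto)
qed

end

section \<open>From triangulations to persistent graphs\<close>

locale triangulated_curve = curve N t for N t +
  fixes n :: nat and T :: "nat set set"
  assumes tri: "triangulation n t T" and N_eq: "N = n + 1" and n2: "2 \<le> n"
begin

lemma simplex: "S \<in> T \<Longrightarrow> S \<subseteq> {..N}" "S \<in> T \<Longrightarrow> card S = 4"
  using tri unfolding triangulation_def N_eq atLeast0AtMost by blast+

lemma hull_Int:
  "S1 \<in> T \<Longrightarrow> S2 \<in> T \<Longrightarrow> convex hull (cpt t ` S1) \<inter> convex hull (cpt t ` S2) = convex hull (cpt t ` (S1 \<inter> S2))"
  using tri unfolding triangulation_def by blast

lemma no_circuit:
  assumes "S1 \<in> T" "S2 \<in> T" "a < b" "b < c" "c < d" "d < e" "{a,c,e} \<subseteq> S1" "{b,d} \<subseteq> S2"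
  shows False
  using no_circuit_if_hull_Int[of S1 S2 a b c d e] simplex[OF assms(1)] simplex[OF assms(2)]
    hull_Int[OF assms(1,2)] assms(3-) by simp

lemma cover:
  assumes "weights {..N} u" "mm u 0 = 1"
  obtains S v where "S \<in> T" "weights S v" "pt u \<in> convex hull (cpt t ` S)"
    "\<And>k. k \<le> 3 \<Longrightarrow> mm u k = mm v k"
proof -
  have "pt u \<in> convex hull (cpt t ` {..N})" using hull_iff[of "{..N}"] assms by blast
  then obtain S where S: "S \<in> T" "pt u \<in> convex hull (cpt t ` S)"
    using tri unfolding triangulation_def N_eq atLeast0AtMost by blast
  then obtain v where v: "weights S v" "mm v 0 = 1" "pt u = pt v" using hull_iff[of S] simplex by blast
  then show ?thesis using that[OF S(1) v(1) S(2)] pt_eqD[of u v] assms by simp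
qed

text \<open>Some simplex contains the midpoint of \<open>a\<close> and \<open>b\<close>. Either its
  weights there are those of the midpoint, so it contains both ends, or there is a circuit; the
  three-element side does not fit into \<open>{a, b}\<close> and so belongs to the simplex.\<close>

lemma edge_or_crossing:
  assumes "a < b" "b \<le> N"
  obtains S where "S \<in> T" "{a,b} \<subseteq> S"
  | S s1 s2 s3 where "S \<in> T" "{s1,s2,s3} \<subseteq> S" "s1 < a" "a < s2" "s2 < b" "b < s3"
proof -
  define u where "u i = (if i = a \<or> i = b then 1/2 else 0 :: real)" for i
  have w: "weights {a,b} u" by (auto simp: weights_def u_def)
  have "mm u 0 = (\<Sum>i\<in>{a,b}. u i * t i ^ 0)"
    by (rule mom_supp) (use assms in \<open>auto simp: u_def\<close>)
  then have m: "mm u 0 = 1" using assms by (simp add: u_def)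
  have ab: "{a,b} \<subseteq> {..N}" using assms by auto
  obtain S v where S: "S \<in> T" "weights S v" "\<And>k. k \<le> 3 \<Longrightarrow> mm u k = mm v k"
    using cover[OF weights_mono[OF w ab] m] by blast
  show ?thesis
  proof (rule weights_eq_or_circuit[OF w S(2,3) ab simplex(1)[OF S(1)]])
    assume "u = v"
    then have "v a > 0" "v b > 0" using u_def[of a] u_def[of b] by simp_all
    then show ?thesis using that(1)[OF S(1)] weightsD(2)[OF S(2)] by blast
  next
    fix a' b' c' d' e' assume "a' < b'" "b' < c'" "c' < d'" "d' < e'" "{a',c',e'} \<subseteq> {a,b}"
    then show ?thesis by auto
  next
    fix a' b' c' d' e' assume l: "a' < b'" "b' < c'" "c' < d'" "d' < e'" "{a',c',e'} \<subseteq> S" "{b',d'} \<subseteq> {a,b}"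
    then have "b' = a" "d' = b" using assms by auto
    then show ?thesis using that(2)[OF S(1) l(5)] l by simp
  qed
qed

text \<open>A crossing triangle would need a vertex strictly between \<open>i\<close> and
  \<open>Suc i\<close>.\<close>

lemma consecutive_edge:
  assumes "i < N"
  obtains S where "S \<in> T" "{i, Suc i} \<subseteq> S"
  by (rule edge_or_crossing[of i "Suc i"]) (use assms in auto)

text \<open>If \<open>{a, d}\<close> is not an edge, some triangle
  \<open>s1 < a < s2 < d < s3\<close> crosses it. This triangle forms a circuit with
  \<open>{a, c}\<close> if \<open>s2 < c\<close>, and with \<open>{b, d}\<close> otherwise.\<close>

lemma X_property:
  assumes "a < b" "b < c" "c < d" "S1 \<in> T" "{a,c} \<subseteq> S1" "S2 \<in> T" "{b,d} \<subseteq> S2"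
  obtains S where "S \<in> T" "{a,d} \<subseteq> S"
proof -
  have "d \<le> N" using simplex(1) assms by blast
  show ?thesis
  proof (rule edge_or_crossing[of a d])
    fix S s1 s2 s3 assume s: "S \<in> T" "{s1,s2,s3} \<subseteq> S" "s1 < a" "a < s2" "s2 < d" "d < s3"
    show ?thesis
    proof (cases "s2 < c")
      case True
      then show ?thesis using no_circuit[OF s(1) assms(4), of s1 a s2 c s3] s assms by auto
    next
      case False
      then show ?thesis using no_circuit[OF s(1) assms(6), of s1 b s2 d s3] s assms by auto
    qed
  qed (use assms \<open>d \<le> N\<close> that in auto)
qed

text \<open>Near the midpoint of an edge \<open>{a, b}\<close>, in the direction of a vertex \<open>k\<close> with \<open>a < k < b\<close>, some simplex
  containing \<open>{a, b}\<close> is met infinitely often; comparing weights, it has a vertex strictly between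
  \<open>a\<close> and \<open>b\<close>.\<close>

lemma bar_property:
  assumes ab: "Suc a < b" and S0: "S0 \<in> T" "{a,b} \<subseteq> S0"
  obtains S x where "S \<in> T" "a < x" "x < b" "{a,x,b} \<subseteq> S"
proof -
  have bN: "b \<le> N" using simplex(1) S0 by blast
  define k where "k = Suc a"
  have k: "a < k" "k < b" using ab unfolding k_def by auto
  define u where "u i = (if i = a \<or> i = b then 1/2 else 0 :: real)" for i
  define g where "g i = (if i = k then 1 else if i = a \<or> i = b then - 1/2 else 0 :: real)" for i
  \<comment> \<open>The point at the fraction \<open>1 / (m + 1)\<close> of the way from the
    midpoint to the vertex \<open>k\<close>.\<close>
  define um where "um m i = u i + (1 / real (Suc m)) * g i" for m i
  have sub: "{a,b} \<subseteq> {..N}" "{a,k,b} \<subseteq> {..N}" using bN k by auto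
  have wu: "weights {a,b} u" by (auto simp: weights_def u_def)
  have "mm u 0 = (\<Sum>i\<in>{a,b}. u i * t i ^ 0)" by (rule mom_supp) (use sub in \<open>auto simp: u_def\<close>)
  then have mu: "mm u 0 = 1" using k by (simp add: u_def)
  have "mm g 0 = (\<Sum>i\<in>{a,k,b}. g i * t i ^ 0)" by (rule mom_supp) (use sub in \<open>auto simp: g_def\<close>)
  then have mg: "mm g 0 = 0" using k by (simp add: g_def)
  have wm: "weights {a,k,b} (um m)" for m
    using k unfolding weights_def um_def u_def g_def by (auto simp: field_simps)
  have mm: "mm (um m) j = mm u j + (1 / real (Suc m)) * mm g j" for m j
    unfolding um_def by (rule mom_add)
  have "\<exists>S. S \<in> T \<and> pt (um m) \<in> convex hull (cpt t ` S)" for m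
    using cover[OF weights_mono[OF wm[of m] sub(2)]] mm[of m 0] mu mg by auto
  then obtain f where f: "\<And>m. f m \<in> T" "\<And>m. pt (um m) \<in> convex hull (cpt t ` (f m))" by metis
  have "finite T" by (rule finite_subset[of T "Pow {..N}"]) (use simplex in auto)
  then have "finite (range f)" using f finite_subset[of "range f" T] by auto
  \<comment> \<open>One simplex receives infinitely many of these points; being closed, it also
    contains their limit, the midpoint.\<close>
  then obtain m0 where inf: "infinite {m. f m = f m0}"
    using pigeonhole_infinite[of UNIV f] by auto
  define S where "S = f m0"
  have S: "S \<in> T" using f S_def by simp
  have fS: "finite S" using simplex(1)[OF S] finite_subset by blast
  have "(\<lambda>m. pt (um m)) \<longlonglongrightarrow> (mm u 1 + 0 * mm g 1, mm u 2 + 0 * mm g 2, mm u 3 + 0 * mm g 3)"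
    unfolding pt_def mm by (intro tendsto_Pair tendsto_add tendsto_mult tendsto_const lim_1_over_n[THEN LIMSEQ_Suc])
  then have lim: "(\<lambda>m. pt (um m)) \<longlonglongrightarrow> pt u" by (simp add: pt_def)
  have cl: "closed (convex hull (cpt t ` S))"
    using fS by (intro compact_imp_closed finite_imp_compact_convex_hull) simp
  have "pt u \<in> convex hull (cpt t ` S)"
  proof (rule ccontr)
    assume "pt u \<notin> convex hull (cpt t ` S)"
    then have "\<forall>\<^sub>F m in sequentially. pt (um m) \<in> - (convex hull (cpt t ` S))"
      by (intro topological_tendstoD[OF lim open_Compl[OF cl]]) simp
    then obtain M where M: "\<And>m. m \<ge> M \<Longrightarrow> pt (um m) \<notin> convex hull (cpt t ` S)"
      unfolding eventually_sequentially by auto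
    obtain m where "m \<ge> M" "f m = f m0" using inf unfolding infinite_nat_iff_unbounded_le by blast
    then show False using M f(2)[of m] unfolding S_def by simp
  qed
  moreover have "pt u \<in> convex hull (cpt t ` S0)"
    using hull_iff[of S0] simplex(1) S0 weights_mono[OF wu S0(2)] mu by blast
  ultimately have "pt u \<in> convex hull (cpt t ` (S0 \<inter> S))" using hull_Int[OF S0(1) S] by blast
  then obtain w where w: "weights (S0 \<inter> S) w" "mm w 0 = 1" "pt u = pt w"
    using hull_iff[of "S0 \<inter> S"] simplex(1) S0 by blast
  \<comment> \<open>Weights are unique in \<open>S0\<close>, so the common face of \<open>S0\<close>
    and \<open>S\<close> that contains the midpoint has both \<open>a\<close> and \<open>b\<close>
    as vertices.\<close>
  have "u = w"
    by (rule weights_unique[OF weights_mono[OF wu S0(2)] weights_mono[OF w(1)]])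
      (use pt_eqD[of u w] mu w simplex S0 in auto)
  then have "w a > 0" "w b > 0" using u_def[of a] u_def[of b] by simp_all
  then have abS: "a \<in> S" "b \<in> S" using weightsD(2)[OF w(1)] by auto
  obtain v where v: "weights S v" "mm v 0 = 1" "pt (um m0) = pt v"
    using hull_iff[of S] simplex(1)[OF S] f(2)[of m0] unfolding S_def by blast
  have eq: "mm (um m0) j = mm v j" if "j \<le> 3" for j
    using pt_eqD[of "um m0" v j] v mm[of m0 0] mu mg that by simp
  have "\<exists>x. a < x \<and> x < b \<and> x \<in> S"
  \<comment> \<open>Equal weights put \<open>k\<close> into \<open>S\<close>. In a circuit of either
    kind, some index from \<open>S\<close> is flanked by two indices from
    \<open>{a, k, b}\<close>.\<close>
  proof (rule weights_eq_or_circuit[OF wm v(1) eq sub(2) simplex(1)[OF S]])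
    assume "um m0 = v"
    moreover have "um m0 k > 0" using k by (simp add: um_def u_def g_def)
    ultimately show ?thesis using k weightsD(2)[OF v(1), of k] by auto
  next
    fix a' b' c' d' e' assume "a' < b'" "b' < c'" "{a',c',e'} \<subseteq> {a,k,b}" "{b',d'} \<subseteq> S"
    then show ?thesis using k by (intro exI[of _ b']) auto
  next
    fix a' b' c' d' e' assume "b' < c'" "c' < d'" "{a',c',e'} \<subseteq> S" "{b',d'} \<subseteq> {a,k,b}"
    then show ?thesis using k by (intro exI[of _ c']) auto
  qed
  then show ?thesis using that[OF S] abS by blast
qed

lemma GammaI:
  assumes "S \<in> T" "{i,j} \<subseteq> S" "i < j" "0 < i" "j \<le> n"
  shows "{i,j} \<in> Gamma n T"
  using assms unfolding Gamma_def F1_def by auto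

lemma GammaE:
  assumes "{i,j} \<in> Gamma n T"
  obtains S where "S \<in> T" "{i,j} \<subseteq> S" "0 < i" "j \<le> n"
  using assms unfolding Gamma_def F1_def by auto

lemma persistent_Gamma: "persistent n (Gamma n T)"
  unfolding persistent_def
proof (intro conjI allI impI; (elim conjE)?)
  show "\<forall>e\<in>Gamma n T. card e = 2 \<and> e \<subseteq> {1..n}" unfolding Gamma_def F1_def by auto
next
  fix i assume i: "1 \<le> i" "i < n"
  obtain S where "S \<in> T" "{i, Suc i} \<subseteq> S" by (rule consecutive_edge[of i]) (use i N_eq in auto)
  then show "{i, i + 1} \<in> Gamma n T" using GammaI[of S i "Suc i"] i by simp
next
  fix a b c d assume lt: "a < b" "b < c" "c < d" and e: "{a,c} \<in> Gamma n T" "{b,d} \<in> Gamma n T"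
  obtain S1 where S1: "S1 \<in> T" "{a,c} \<subseteq> S1" "0 < a" by (rule GammaE[OF e(1)])
  obtain S2 where S2: "S2 \<in> T" "{b,d} \<subseteq> S2" "d \<le> n" by (rule GammaE[OF e(2)])
  obtain S where "S \<in> T" "{a,d} \<subseteq> S" by (rule X_property[OF lt S1(1,2) S2(1,2)])
  then show "{a,d} \<in> Gamma n T" using GammaI[of S a d] lt S1(3) S2(3) by simp
next
  fix a b assume e: "{a,b} \<in> Gamma n T" and "a < b - 1"
  then have ab: "Suc a < b" by simp
  obtain S0 where S0: "S0 \<in> T" "{a,b} \<subseteq> S0" "0 < a" "b \<le> n" by (rule GammaE[OF e])
  obtain S x where S: "S \<in> T" "a < x" "x < b" "{a,x,b} \<subseteq> S" by (rule bar_property[OF ab S0(1,2)])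
  then have "{a,x} \<in> Gamma n T" "{x,b} \<in> Gamma n T"
    using GammaI[of S a x] GammaI[of S x b] S0(3,4) by auto
  then show "\<exists>x. a < x \<and> x < b \<and> {a,x} \<in> Gamma n T \<and> {x,b} \<in> Gamma n T" using S by blast
qed

section \<open>Recovering a triangulation from its graph\<close>

lemma hatH_GammaI:
  assumes "S \<in> T" "{i,j} \<subseteq> S" "i < j"
  shows "hatH n (Gamma n T) i j"
  using GammaI[OF assms] simplex(1)[OF assms(1)] assms(2,3) N_eq
  by (cases "i = 0 \<or> j = n + 1") (auto simp: hatH_iff)

text \<open>A simplex \<open>a < b < c < d\<close> of \<open>T\<close> is the one belonging to
  \<open>{b, c}\<close>: an edge \<open>{i, c}\<close> with \<open>a < i < b\<close> would form a
  circuit with the triangle \<open>{a, b, d}\<close>, and an edge \<open>{b, i}\<close> with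
  \<open>c < i < d\<close> one with \<open>{a, c, d}\<close>.\<close>

lemma subset_Xi_Gamma: "T \<subseteq> Xi n (Gamma n T)"
proof
  fix S assume S: "S \<in> T"
  obtain a b c d where abcd: "S = {a,b,c,d}" "a < b" "b < c" "c < d" by (rule four_set[OF simplex(2)[OF S]])
  then have dN: "d \<le> n + 1" using simplex(1)[OF S] N_eq by auto
  have "hatH n (Gamma n T) a c" "hatH n (Gamma n T) b d"
    using hatH_GammaI[OF S] abcd by auto
  moreover have "{b,c} \<in> Gamma n T" using GammaI[OF S, of b c] abcd dN by auto
  moreover have "\<not> hatH n (Gamma n T) i c" if i: "a < i" "i < b" for i
  proof
    assume "hatH n (Gamma n T) i c"
    then have "{i,c} \<in> Gamma n T" using i abcd(3,4) dN by (auto simp: hatH_iff)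
    then obtain S2 where "S2 \<in> T" "{i,c} \<subseteq> S2" by (rule GammaE)
    then show False using no_circuit[OF S, of S2 a i b c d] i abcd by auto
  qed
  moreover have "\<not> hatH n (Gamma n T) b i" if i: "c < i" "i < d" for i
  proof
    assume "hatH n (Gamma n T) b i"
    then have "{b,i} \<in> Gamma n T" using i abcd(2) dN by (auto simp: hatH_iff)
    then obtain S2 where "S2 \<in> T" "{b,i} \<subseteq> S2" by (rule GammaE)
    then show False using no_circuit[OF S, of S2 a b c i d] i abcd by auto
  qed
  ultimately have "is_quad n (Gamma n T) a b c d" using abcd(3) by (simp add: is_quad_def abcd)
  then show "S \<in> Xi n (Gamma n T)"
    using Xi_I[OF persistent_card2[OF persistent_Gamma]] abcd(1) by simp
qed

text \<open>The barycentre of a simplex \<open>S\<close> of \<open>T'\<close> lies in some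
  \<open>S'\<close> of \<open>T\<close>, hence in their common face. Its weights are positive on all
  of \<open>S\<close>, so \<open>S\<close> is contained in \<open>S'\<close>, and equal
  cardinalities make them equal.\<close>

lemma triangulation_maximal:
  assumes tri': "triangulation n t T'" and sub: "T \<subseteq> T'"
  shows "T' = T"
proof -
  interpret T': triangulated_curve N t n T' by unfold_locales (use tri' N_eq n2 in auto)
  have "S \<in> T" if S: "S \<in> T'" for S
  proof -
    define u where "u i = (if i \<in> S then 1/4 else 0 :: real)" for i
    note s = T'.simplex[OF S]
    have w: "weights S u" by (auto simp: weights_def u_def)
    have "mm u 0 = (\<Sum>i\<in>S. u i * t i ^ 0)" by (rule mom_supp) (use s in \<open>auto simp: u_def\<close>)
    also have "\<dots> = (\<Sum>i\<in>S. 1/4)" by (rule sum.cong) (auto simp: u_def)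
    finally have m: "mm u 0 = 1" using s by simp
    obtain S' v where S': "S' \<in> T" "pt u \<in> convex hull (cpt t ` S')"
      by (rule cover[OF weights_mono[OF w s(1)] m])
    moreover have "pt u \<in> convex hull (cpt t ` S)" using hull_iff[of S] s w m by blast
    ultimately have "pt u \<in> convex hull (cpt t ` (S \<inter> S'))" using T'.hull_Int[OF S, of S'] sub by blast
    then obtain v where v: "weights (S \<inter> S') v" "mm v 0 = 1" "pt u = pt v"
      using hull_iff[of "S \<inter> S'"] s by blast
    have "u = v"
      by (rule weights_unique[OF w weights_mono[OF v(1)]]) (use pt_eqD[of u v] m v s in auto)
    have "S \<subseteq> S'"
    proof
      fix i assume "i \<in> S"
      then have "v i > 0" using \<open>u = v\<close> u_def[of i] by simp
      then show "i \<in> S'" using weightsD(2)[OF v(1)] by blast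
    qed
    then have "S = S'" using simplex[OF S'(1)] s finite_subset[of S' "{..N}"] by (intro card_subset_eq) auto
    then show ?thesis using S' by simp
  qed
  then show ?thesis using sub by blast
qed

lemma Xi_Gamma: "Xi n (Gamma n T) = T"
  by (rule triangulation_maximal[OF triangulation_Xi[OF persistent_Gamma N_eq n2] subset_Xi_Gamma])

end

theorem theorem13:
  fixes n :: nat and t :: "nat \<Rightarrow> real"
  assumes "n \<ge> 2"
    and "strict_mono_on {0..n+1} t"
  shows "(\<forall>T. triangulation n t T \<longrightarrow> persistent n (Gamma n T))
       \<and> (\<forall>E. persistent n E \<longrightarrow> triangulation n t (Xi n E))
       \<and> (\<forall>T. triangulation n t T \<longrightarrow> Xi n (Gamma n T) = T)
       \<and> (\<forall>E. persistent n E \<longrightarrow> Gamma n (Xi n E) = E)"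
proof -
  interpret curve "n + 1" t by unfold_locales (use assms(2) in \<open>simp add: atLeast0AtMost\<close>)
  have T: "triangulated_curve (n + 1) t n T" if "triangulation n t T" for T
    by unfold_locales (use that assms(1) in auto)
  show ?thesis
    using T[THEN triangulated_curve.persistent_Gamma] T[THEN triangulated_curve.Xi_Gamma]
      triangulation_Xi[OF _ refl assms(1)] Gamma_Xi by blast
qed

end
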